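(* Let $\Phi\in\mathrm{End}(\mathcal{Q})$ and $n\ge0$, suppose that $\Phi_n$ has the partitioning property (with set of equivalence classes $E$) and that the numbers $c_{\alpha,(n)}$, $\alpha\in\operatorname{Comp}(n)$, are nonnegative and not all zero. Then $\widehat{K}$ has a unique stationary distribution if and only if there is some $\alpha\in\operatorname{Comp}(n)\setminus\{(n),(1^n)\}$ with $c_{\alpha,(n)}\neq0$. In this case the stationary distribution is the lumped uniform distribution $B\mapsto\#\{\sigma\in\mathfrak{S}_n:D(\sigma)\in B\}/n!$, $B\in E$.
   Context: Work over $\mathbb{Q}$. Compositions $\alpha=(a_1,\dots,a_k)$ of $n$, $\operatorname{Comp}(n)$, $(n)$, $(1^n)$, $S_\alpha=\{a_1,\dots,a_1+\dots+a_{k-1}\}$, $\operatorname{co}$ its inverse, $\alpha\le\beta$ iff $S_\alpha\subseteq S_\beta$. $M_\alpha=\sum_{i_1<\dots<i_k}x_{i_1}^{a_1}\cdots x_{i_k}^{a_k}$, $\mathcal{Q}_n$ their span, $\mathcal{Q}$ the graded Hopf algebra of quasisymmetric functions, $F_\alpha=\sum_{\beta\ge\alpha}M_\beta$. $\mathrm{End}(\mathcal{Q})$ = graded Hopf algebra endomorphisms, $\Phi_n=\Phi|_{\mathcal{Q}_n}$. For $\sigma\in\mathfrak{S}_n$, $D(\sigma)=\operatorname{co}(\{i:\sigma_i>\sigma_{i+1}\})$. Define $c_{\alpha,\beta}$ by $\Phi(F_\alpha)=\sum_\beta c_{\alpha,\beta}F_\beta$ and $\lambda$ by $\Phi(M_{(1)})=\lambda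 M_{(1)}$. $\Phi_n$ has the partitioning property if there is an equivalence relation on $\operatorname{Comp}(n)$, with set of classes $E$, such that $\Phi(F_\alpha)=\Phi(F_\beta)$ for equivalent $\alpha,\beta$, and with $\phi_A=\Phi(F_\alpha)$ ($\alpha\in A$), $\{\phi_A\}_{A\in E}$ is a basis of $\Phi(\mathcal{Q}_n)$. Define $d_{A,B}$ by $\Phi(\phi_A)=\sum_B d_{A,B}\phi_B$ and $\widehat{K}(A,B)=d_{A,B}/\lambda^n$ (a stochastic matrix under these hypotheses). A stationary distribution is a probability row vector $\mu$ on $E$ with $\mu\widehat{K}=\mu$.
   Formalization: The equivalence is stated only for n ≥ 3: for n ≤ 2 no α other than (n), (1^n) exists, yet the stationary distribution can be unique (e.g. Φ the identity, n = 1), so the claim fails there. The lumped uniform claim is kept for all n ≥ 0, whenever the stationary distribution is unique. *)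

theory Defs
  imports
    Complex_Main
    "HOL-Library.FuncSet"
    "HOL-Library.Function_Algebras"
    "HOL-Library.Poly_Mapping"
    "HOL-Combinatorics.Permutations"
begin

section \<open>Compositions\<close>

definition Comp :: "nat \<Rightarrow> nat list set" where
  "Comp n = {\<alpha>. (\<forall>a\<in>set \<alpha>. 0 < a) \<and> sum_list \<alpha> = n}"

definition Comps :: "nat list set" where
  "Comps = (\<Union>n. Comp n)"

definition one_row :: "nat \<Rightarrow> nat list" where
  "one_row n = (if n = 0 then [] else [n])"

definition one_col :: "nat \<Rightarrow> nat list" where
  "one_col n = replicate n 1"

definition part_sums :: "nat list \<Rightarrow> nat set" where
  "part_sums \<alpha> = {sum_list (take i \<alpha>) |i. 0 < i \<and> i < length \<alpha>}"

definition co :: "nat \<Rightarrow> nat set \<Rightarrow> nat list" where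
  "co n = the_inv_into (Comp n) part_sums"

definition Dcomp :: "nat \<Rightarrow> (nat \<Rightarrow> nat) \<Rightarrow> nat list" where
  "Dcomp n \<sigma> = co n {i. 1 \<le> i \<and> i < n \<and> \<sigma> i > \<sigma> (i + 1)}"


section \<open>Rational vector spaces of functions\<close>

definition fscale :: "rat \<Rightarrow> ('x \<Rightarrow> rat) \<Rightarrow> 'x \<Rightarrow> rat" where
  "fscale c f = (\<lambda>x. c * f x)"

interpretation fvs: vector_space "fscale :: rat \<Rightarrow> ('x \<Rightarrow> rat) \<Rightarrow> 'x \<Rightarrow> rat"
  by unfold_locales (auto simp: fscale_def fun_eq_iff algebra_simps)

text \<open>
  A family \<open>b\<close> is a basis of \<open>V\<close> as a family indexed by \<open>I\<close>: in particular
  distinct indices must give distinct vectors. For such a family, \<open>coord b I v i\<close> is the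
  coefficient of \<open>b i\<close> in the expansion of \<open>v\<close>.
\<close>

definition basis_of :: "('i \<Rightarrow> 'x \<Rightarrow> rat) \<Rightarrow> 'i set \<Rightarrow> ('x \<Rightarrow> rat) set \<Rightarrow> bool" where
  "basis_of b I V \<longleftrightarrow> inj_on b I \<and> fvs.independent (b ` I) \<and> fvs.span (b ` I) = V"

definition coord :: "('i \<Rightarrow> 'x \<Rightarrow> rat) \<Rightarrow> 'i set \<Rightarrow> ('x \<Rightarrow> rat) \<Rightarrow> 'i \<Rightarrow> rat" where
  "coord b I v i = fvs.representation (b ` I) v (b i)"


section \<open>Quasisymmetric functions\<close>

text \<open>
  A monomial in the variables \<open>x\<^sub>0, x\<^sub>1, x\<^sub>2, \<dots>\<close> is its finitely supported exponent vector, and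
  a formal power series is its coefficient function. Addition is the pointwise addition of
  functions; multiplication is \<open>ps_mult\<close> with unit \<open>ps_one\<close>, and not the pointwise
  \<open>(*)\<close> and \<open>1\<close> of \<open>Function_Algebras\<close>.
\<close>

type_synonym mono = "nat \<Rightarrow>\<^sub>0 nat"
type_synonym pser = "mono \<Rightarrow> rat"

definition ps_one :: pser where
  "ps_one m = (if m = 0 then 1 else 0)"

definition ps_mult :: "pser \<Rightarrow> pser \<Rightarrow> pser" where
  "ps_mult f g m = (\<Sum>(u, v)\<in>{(u, v). u + v = m}. f u * g v)"

text \<open>
  The coefficient of a monomial in \<open>M\<^sub>\<alpha>\<close> is the number of strictly increasing index sequences
  \<open>i\<^sub>1 < \<dots> < i\<^sub>k\<close> whose term \<open>x\<^bsub>i\<^sub>1\<^esub>^a\<^sub>1 \<cdots> x\<^bsub>i\<^sub>k\<^esub>^a\<^sub>k\<close> is that monomial.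
\<close>

definition QM :: "nat list \<Rightarrow> pser" where
  "QM \<alpha> m = of_nat (card {xs :: nat list. length xs = length \<alpha> \<and> sorted_wrt (<) xs \<and>
     (\<Sum>j<length \<alpha>. Poly_Mapping.single (xs ! j) (\<alpha> ! j)) = m})"

definition QF :: "nat list \<Rightarrow> pser" where
  "QF \<alpha> = (\<Sum>\<beta>\<in>{\<beta> \<in> Comp (sum_list \<alpha>). part_sums \<alpha> \<subseteq> part_sums \<beta>}. QM \<beta>)"

definition Qdeg :: "nat \<Rightarrow> pser set" where
  "Qdeg n = fvs.span (QM ` Comp n)"

definition QSym :: "pser set" where
  "QSym = fvs.span (QM ` Comps)"


section \<open>Hopf algebra structure\<close>

text \<open>
  The tensor square of \<open>QSym\<close> is realised inside the power series in two independent
  alphabets: the simple tensor of \<open>f\<close> and \<open>g\<close> is \<open>f(x) g(y)\<close>, and the products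
  \<open>M\<^sub>\<alpha>(x) M\<^sub>\<beta>(y)\<close> form a basis.
\<close>

definition tensor :: "pser \<Rightarrow> pser \<Rightarrow> mono \<times> mono \<Rightarrow> rat" where
  "tensor f g = (\<lambda>(u, v). f u * g v)"

definition tensor_coord :: "(mono \<times> mono \<Rightarrow> rat) \<Rightarrow> nat list \<times> nat list \<Rightarrow> rat" where
  "tensor_coord T = coord (\<lambda>(\<alpha>, \<beta>). tensor (QM \<alpha>) (QM \<beta>)) (Comps \<times> Comps) T"

definition tensor_map ::
    "(pser \<Rightarrow> pser) \<Rightarrow> (pser \<Rightarrow> pser) \<Rightarrow> (mono \<times> mono \<Rightarrow> rat) \<Rightarrow> mono \<times> mono \<Rightarrow> rat" where
  "tensor_map \<Phi> \<Psi> T =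
     (\<Sum>(\<alpha>, \<beta>)\<in>{p \<in> Comps \<times> Comps. tensor_coord T p \<noteq> 0}.
        fscale (tensor_coord T (\<alpha>, \<beta>)) (tensor (\<Phi> (QM \<alpha>)) (\<Psi> (QM \<beta>))))"

text \<open>
  The coproduct is deconcatenation in the basis of the \<open>M\<^sub>\<alpha>\<close>, extended linearly; the counit is
  the constant coefficient.
\<close>

definition qcoprod :: "pser \<Rightarrow> mono \<times> mono \<Rightarrow> rat" where
  "qcoprod f =
     (\<Sum>\<alpha>\<in>{\<alpha> \<in> Comps. coord QM Comps f \<alpha> \<noteq> 0}.
        fscale (coord QM Comps f \<alpha>)
          (\<Sum>i\<le>length \<alpha>. tensor (QM (take i \<alpha>)) (QM (drop i \<alpha>))))"

definition qcounit :: "pser \<Rightarrow> rat" where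
  "qcounit f = f 0"

text \<open>
  Only the values of \<open>\<Phi>\<close> on \<open>QSym\<close> matter. Compatibility with the antipode is not listed,
  since every bialgebra morphism between Hopf algebras commutes with the antipodes.
\<close>

definition hopf_End :: "(pser \<Rightarrow> pser) set" where
  "hopf_End = {\<Phi>.
     (\<forall>f\<in>QSym. \<forall>g\<in>QSym. \<Phi> (f + g) = \<Phi> f + \<Phi> g) \<and>
     (\<forall>c. \<forall>f\<in>QSym. \<Phi> (fscale c f) = fscale c (\<Phi> f)) \<and>
     (\<forall>n. \<Phi> ` Qdeg n \<subseteq> Qdeg n) \<and>
     \<Phi> ps_one = ps_one \<and>
     (\<forall>f\<in>QSym. \<forall>g\<in>QSym. \<Phi> (ps_mult f g) = ps_mult (\<Phi> f) (\<Phi> g)) \<and>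
     (\<forall>f\<in>QSym. qcounit (\<Phi> f) = qcounit f) \<and>
     (\<forall>f\<in>QSym. qcoprod (\<Phi> f) = tensor_map \<Phi> \<Phi> (qcoprod f))}"


section \<open>The chain associated with an endomorphism\<close>

definition cmat :: "(pser \<Rightarrow> pser) \<Rightarrow> nat list \<Rightarrow> nat list \<Rightarrow> rat" where
  "cmat \<Phi> \<alpha> \<beta> = coord QF Comps (\<Phi> (QF \<alpha>)) \<beta>"

definition lam :: "(pser \<Rightarrow> pser) \<Rightarrow> rat" where
  "lam \<Phi> = (THE l. \<Phi> (QM [1]) = fscale l (QM [1]))"

definition class_val :: "(pser \<Rightarrow> pser) \<Rightarrow> nat list set \<Rightarrow> pser" where
  "class_val \<Phi> A = \<Phi> (QF (SOME \<alpha>. \<alpha> \<in> A))"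

text \<open>
  \<open>\<Phi>\<^sub>n\<close> has the partitioning property, witnessed by the equivalence relation \<open>r\<close>; the set of
  classes is \<open>Comp n // r\<close>.
\<close>

definition partitioning :: "(pser \<Rightarrow> pser) \<Rightarrow> nat \<Rightarrow> (nat list \<times> nat list) set \<Rightarrow> bool" where
  "partitioning \<Phi> n r \<longleftrightarrow>
     equiv (Comp n) r \<and>
     (\<forall>(\<alpha>, \<beta>)\<in>r. \<Phi> (QF \<alpha>) = \<Phi> (QF \<beta>)) \<and>
     basis_of (class_val \<Phi>) (Comp n // r) (\<Phi> ` Qdeg n)"

definition dmat :: "(pser \<Rightarrow> pser) \<Rightarrow> nat list set set \<Rightarrow> nat list set \<Rightarrow> nat list set \<Rightarrow> rat" where
  "dmat \<Phi> E A B = coord (class_val \<Phi>) E (\<Phi> (class_val \<Phi> A)) B"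

definition Khat ::
    "(pser \<Rightarrow> pser) \<Rightarrow> nat \<Rightarrow> nat list set set \<Rightarrow> nat list set \<Rightarrow> nat list set \<Rightarrow> rat" where
  "Khat \<Phi> n E A B = dmat \<Phi> E A B / lam \<Phi> ^ n"

text \<open>
  A row vector on \<open>E\<close> is a real function with domain \<open>E\<close>, made unique outside \<open>E\<close> by
  extensionality.
\<close>

definition stationary :: "'s set \<Rightarrow> ('s \<Rightarrow> 's \<Rightarrow> rat) \<Rightarrow> ('s \<Rightarrow> real) \<Rightarrow> bool" where
  "stationary E K \<mu> \<longleftrightarrow>
     \<mu> \<in> E \<rightarrow>\<^sub>E {0..} \<and> (\<Sum>A\<in>E. \<mu> A) = 1 \<and>
     (\<forall>B\<in>E. (\<Sum>A\<in>E. \<mu> A * of_rat (K A B)) = \<mu> B)"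

definition lumped_uniform :: "nat \<Rightarrow> nat list set set \<Rightarrow> nat list set \<Rightarrow> real" where
  "lumped_uniform n E =
     (\<lambda>B\<in>E. real (card {\<sigma>. \<sigma> permutes {1..n} \<and> Dcomp n \<sigma> \<in> B}) / fact n)"

end

theory Submission
  imports Defs
begin

text \<open>
  Let \<open>\<chi>(\<sigma>) = c\<^bsub>D(\<sigma>),(n)\<^esub>\<close>. Comultiplicativity of \<open>\<Phi>\<close> expresses the coefficient of \<open>M\<^sub>\<beta>\<close> in
  \<open>\<Phi>(F\<^bsub>D(\<pi>)\<^esub>)\<close> as a product over the blocks of \<open>\<beta>\<close> of values of the character attached to \<open>\<Phi>\<close>,
  and multiplicativity together with the shuffle product of fundamental quasisymmetric functions turns
  this into the sum of \<open>\<chi>(\<pi> \<tau>\<^sup>-\<^sup>1)\<close> over the \<open>\<tau>\<close> with descents in the partial sums of \<open>\<beta>\<close>. Hence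
  \<open>\<Phi>(F\<^bsub>D(\<pi>)\<^esub>) = \<Sum>\<^sub>\<tau> \<chi>(\<pi> \<tau>\<^sup>-\<^sup>1) F\<^bsub>D(\<tau>)\<^esub>\<close> and \<open>\<Sum>\<^sub>\<sigma> \<chi>(\<sigma>) = \<lambda>^n\<close>: the chain is the lumping, along the
  descent composition and then the classes, of the random walk \<open>\<pi> \<mapsto> w\<^sup>-\<^sup>1 \<pi>\<close> on the symmetric group
  whose steps \<open>w\<close> have weight \<open>\<chi>(w) / \<lambda>^n\<close>. The uniform distribution is stationary for the walk. A
  descent class other than those of \<open>(n)\<close> and \<open>(1\<^sup>n)\<close> generates the group, which gives uniqueness.
  If only these two carry weight, the walk only reverses values, and every pair \<open>{\<pi>, w\<^sub>0 \<pi>}\<close> supports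
  a stationary distribution; not all of these coincide.
\<close>

section \<open>Families with dual evaluation points\<close>

text \<open>Coefficients are read off by evaluation. A homogeneous quasisymmetric function is
  determined by its values at packed monomials, and the monomial basis is dual to these points, so
  every use of the Hopf structure becomes an identity between numbers.

  The shuffle rule is obtained from words. A product of fundamental functions counts words whose
  order conditions are lifted at the seams between the factors; sorting such words, with ties broken
  by a permutation, splits the count into fundamental functions again. This is what
  \<open>word_gf\<close> is made for.

  The character used throughout is the evaluation at \<open>x\<^sub>0 = 1\<close> with all other
  variables 0. It reads the coefficient of \<open>M_(n)\<close>, and only \<open>F_(n)\<close> among
  the fundamental functions of degree \<open>n\<close> involves \<open>M_(n)\<close>; hence its
  values on images of fundamental functions are the numbers \<open>c_{\<alpha>,(n)}\<close>.

  The equivalence is stated for \<open>3 \<le> n\<close>. For smaller \<open>n\<close> there is no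
  composition besides \<open>(n)\<close> and \<open>(1^n)\<close>, yet for \<open>n \<le> 1\<close>
  there is a single class and therefore a unique stationary distribution. The form of a unique
  distribution needs no such bound, because the lumped uniform one is always stationary.\<close>

lemma fscale_apply: "fscale c f x = c * f x"
  by (simp add: fscale_def)

lemma sum_fun_apply: "(\<Sum>i\<in>I. f i) x = (\<Sum>i\<in>I. f i x :: rat)"
  by (induction I rule: infinite_finite_induct) auto

text \<open>Evaluation at \<open>p j\<close> is a linear functional that kills every member of the
  family except \<open>b j\<close>, so these evaluations act as a dual basis.\<close>

lemma dual_points_basis:
  fixes b :: "'i \<Rightarrow> 'x \<Rightarrow> rat"
  assumes dual: "\<And>i j. i \<in> I \<Longrightarrow> j \<in> I \<Longrightarrow> b i (p j) = (if i = j then 1 else 0)"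
  shows dual_points_inj: "inj_on b I"
    and dual_points_independent: "fvs.independent (b ` I)"
proof -
  show inj: "inj_on b I"
    using dual by (metis inj_onI zero_neq_one)
  show "fvs.independent (b ` I)"
    proof (rule fvs.independent_explicit_module[THEN iffD2], intro allI impI)
    fix T u v
    assume T: "finite T" "T \<subseteq> b ` I" and 0: "(\<Sum>v\<in>T. fscale (u v) v) = 0" and v: "v \<in> T"
    obtain j where j: "j \<in> I" "v = b j"
      using T v by auto
    have "0 = (\<Sum>w\<in>T. u w * w (p j))"
      using fun_cong[OF 0, of "p j"] by (simp add: sum_fun_apply fscale_apply)
    also have "\<dots> = (\<Sum>w\<in>T. if w = v then u v else 0)"
    proof (rule sum.cong[OF refl])
      fix w assume "w \<in> T"
      then obtain i where "i \<in> I" "w = b i"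
        using T by auto
      then show "u w * w (p j) = (if w = v then u v else 0)"
        using dual[OF \<open>i \<in> I\<close> j(1)] j inj by (auto dest: inj_onD)
    qed
    finally show "u v = 0"
      using T v by simp
  qed
qed

lemma coord_sum:
  assumes inj: "inj_on b I" and ind: "fvs.independent (b ` I)"
    and "J \<subseteq> I" "finite J" "i \<in> I"
  shows "coord b I (\<Sum>j\<in>J. fscale (c j) (b j)) i = (if i \<in> J then c i else 0)"
proof -
  have "coord b I (\<Sum>j\<in>J. fscale (c j) (b j)) i
      = (\<Sum>j\<in>J. fvs.representation (b ` I) (fscale (c j) (b j)) (b i))"
    unfolding coord_def using assms
    by (subst fvs.representation_sum) (auto intro!: fvs.span_scale intro: fvs.span_base)
  also have "\<dots> = (\<Sum>j\<in>J. if j = i then c i else 0)"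
    using assms by (intro sum.cong[OF refl], subst fvs.representation_scale)
      (auto intro: fvs.span_base simp: fvs.representation_basis inj_on_eq_iff subsetD)
  also have "\<dots> = (if i \<in> J then c i else 0)"
    using assms by simp
  finally show ?thesis .
qed

lemma span_family_finite_sum:
  assumes "v \<in> fvs.span (b ` I)" 
  obtains J c where "finite J" "J \<subseteq> I" "v = (\<Sum>j\<in>J. fscale (c j) (b j))"
proof -
  have "\<exists>J c. finite J \<and> J \<subseteq> I \<and> v = (\<Sum>j\<in>J. fscale (c j) (b j))"
    using assms
  proof (induction rule: fvs.span_induct_alt)
    case base
    show ?case by (intro exI[of _ "{}"]) auto
  next
    case (step k x y)
    then obtain J c i where *: "finite J" "J \<subseteq> I" "y = (\<Sum>j\<in>J. fscale (c j) (b j))" "i \<in> I" "x = b i"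
      by auto
    \<comment> \<open>The index \<open>i\<close> may already occur in \<open>J\<close>; its old
      coefficient is then added to \<open>k\<close>.\<close>
    define c' where "c' = (\<lambda>j. if j = i then k + (if i \<in> J then c i else 0) else c j)"
    have eq: "(\<Sum>j\<in>J - {i}. fscale (c' j) (b j)) = (\<Sum>j\<in>J - {i}. fscale (c j) (b j))"
      by (auto simp: c'_def intro!: sum.cong)
    have "(\<Sum>j\<in>insert i J. fscale (c' j) (b j)) = fscale k x + y"
      unfolding sum.insert_remove[OF *(1)] eq *(3) *(5)
      using *(1) by (cases "i \<in> J") (auto simp: c'_def sum.remove[of J i] fvs.scale_left_distrib)
    then show ?case
      using * by (intro exI[of _ "insert i J"] exI[of _ c']) auto
  qed
  then show thesis using that by blast
qed

lemma coord_dual_point: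
  fixes b :: "'i \<Rightarrow> 'x \<Rightarrow> rat"
  assumes dual: "\<And>i j. i \<in> I \<Longrightarrow> j \<in> I \<Longrightarrow> b i (p j) = (if i = j then 1 else 0)"
    and v: "v \<in> fvs.span (b ` I)" and i: "i \<in> I"
  shows "coord b I v i = v (p i)"
proof -
  obtain J c where J: "finite J" "J \<subseteq> I" and veq: "v = (\<Sum>j\<in>J. fscale (c j) (b j))"
    using span_family_finite_sum[OF v] .
  have "v (p i) = (\<Sum>j\<in>J. if j = i then c i else 0)"
    unfolding veq sum_fun_apply fscale_apply using J i by (intro sum.cong) (auto simp: dual subset_iff)
  also have "\<dots> = coord b I v i"
    using J(1) coord_sum[OF dual_points_basis[of I b p, OF dual] J(2,1) i, of c]
    unfolding veq by simp
  finally show ?thesis by simp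
qed

text \<open>\<open>qcoprod\<close> and \<open>tensor_map\<close> sum over such supports, and a sum
  over an infinite set would default to 0.\<close>

lemma finite_coord_support:
  assumes inj: "inj_on b I"
  shows "finite {i \<in> I. coord b I v i \<noteq> 0}"
proof (rule finite_imageD)
  show "finite (b ` {i \<in> I. coord b I v i \<noteq> 0})"
    by (rule finite_subset[OF _ fvs.finite_representation[of "b ` I" v]]) (auto simp: coord_def)
  show "inj_on b {i \<in> I. coord b I v i \<noteq> 0}"
    using inj by (rule inj_on_subset) auto
qed

lemma sum_coord:
  assumes inj: "inj_on b I" and ind: "fvs.independent (b ` I)" and v: "v \<in> fvs.span (b ` I)"
  shows "(\<Sum>i\<in>{i \<in> I. coord b I v i \<noteq> 0}. fscale (coord b I v i) (b i)) = v"
proof -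
  obtain J c where J: "finite J" "J \<subseteq> I" and veq: "v = (\<Sum>j\<in>J. fscale (c j) (b j))"
    using span_family_finite_sum[OF v] .
  have c: "coord b I v i = (if i \<in> J then c i else 0)" if "i \<in> I" for i
    unfolding veq using coord_sum[OF inj ind J(2,1) that] .
  have "(\<Sum>i\<in>{i \<in> I. coord b I v i \<noteq> 0}. fscale (coord b I v i) (b i))
      = (\<Sum>j\<in>J. fscale (c j) (b j))"
    by (rule sum.mono_neutral_cong_left[OF J(1)]) (use J c in \<open>auto split: if_splits\<close>)
  then show ?thesis
    using veq by simp
qed


section \<open>Compositions and their partial sums\<close>

lemma Comp_Cons [simp]: "a # \<alpha> \<in> Comp n \<longleftrightarrow> 0 < a \<and> a \<le> n \<and> \<alpha> \<in> Comp (n - a)"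
  by (auto simp: Comp_def)

lemma Nil_Comp [simp]: "[] \<in> Comp n \<longleftrightarrow> n = 0"
  by (auto simp: Comp_def)

lemma Comp_0 [simp]: "Comp 0 = {[]}"
proof -
  have "\<alpha> \<in> Comp 0 \<longleftrightarrow> \<alpha> = []" for \<alpha> by (cases \<alpha>) auto
  then show ?thesis by auto
qed

lemma sum_list_Comp: "\<alpha> \<in> Comp n \<Longrightarrow> sum_list \<alpha> = n"
  by (simp add: Comp_def)

lemma in_Comps_iff: "\<alpha> \<in> Comps \<longleftrightarrow> \<alpha> \<in> Comp (sum_list \<alpha>)"
  by (auto simp: Comps_def Comp_def)

lemma Comp_Comps: "\<alpha> \<in> Comp n \<Longrightarrow> \<alpha> \<in> Comps"
  by (auto simp: Comps_def)

lemma Comp_append: "\<alpha> \<in> Comp i \<Longrightarrow> \<beta> \<in> Comp j \<Longrightarrow> \<alpha> @ \<beta> \<in> Comp (i + j)"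
  by (auto simp: Comp_def)

lemma append_Comps_iff: "\<alpha> @ \<beta> \<in> Comps \<longleftrightarrow> \<alpha> \<in> Comps \<and> \<beta> \<in> Comps"
  by (auto simp: in_Comps_iff Comp_def)

lemma part_sums_Nil [simp]: "part_sums [] = {}"
  and part_sums_single [simp]: "part_sums [a] = {}"
  by (auto simp: part_sums_def)

lemma part_sums_append:
  assumes "\<alpha> \<noteq> []" "\<beta> \<noteq> []"
  shows "part_sums (\<alpha> @ \<beta>) = part_sums \<alpha> \<union> insert (sum_list \<alpha>) ((+) (sum_list \<alpha>) ` part_sums \<beta>)"
    (is "?L = ?R")
proof (rule set_eqI, rule iffI)
  fix x assume "x \<in> ?L"
  then obtain i where i: "0 < i" "i < length \<alpha> + length \<beta>" "x = sum_list (take i (\<alpha> @ \<beta>))"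
    by (auto simp: part_sums_def)
  consider "i < length \<alpha>" | "i = length \<alpha>" | "i > length \<alpha>" by linarith
  then show "x \<in> ?R"
  proof cases
    case 3
    then have "x = sum_list \<alpha> + sum_list (take (i - length \<alpha>) \<beta>)" 
      using i by simp
    moreover have "sum_list (take (i - length \<alpha>) \<beta>) \<in> part_sums \<beta>"
      using 3 i by (auto simp: part_sums_def intro!: exI[of _ "i - length \<alpha>"])
    ultimately show ?thesis by auto
  qed (use i in \<open>auto simp: part_sums_def\<close>)
next
  fix x assume "x \<in> ?R"
  then consider "x \<in> part_sums \<alpha>" | "x = sum_list \<alpha>" | y where "y \<in> part_sums \<beta>" "x = sum_list \<alpha> + y"
    by auto
  then show "x \<in> ?L"
  proof cases
    case 1
    then show ?thesis by (force simp: part_sums_def)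
  next
    case 2
    then show ?thesis using assms
      by (auto simp: part_sums_def intro!: exI[of _ "length \<alpha>"])
  next
    case 3
    then obtain i where "0 < i" "i < length \<beta>" "y = sum_list (take i \<beta>)"
      by (auto simp: part_sums_def)
    then show ?thesis using 3
      by (auto simp: part_sums_def intro!: exI[of _ "length \<alpha> + i"])
  qed
qed

lemma part_sums_Cons:
  "\<alpha> \<noteq> [] \<Longrightarrow> part_sums (a # \<alpha>) = insert a ((+) a ` part_sums \<alpha>)"
  using part_sums_append[of "[a]" \<alpha>] by simp

lemma part_sums_subset: "\<alpha> \<in> Comp n \<Longrightarrow> part_sums \<alpha> \<subseteq> {1..<n}"
proof (induction \<alpha> arbitrary: n)
  case (Cons a \<alpha>)
  show ?case
  proof (cases "\<alpha> = []")
    case False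
    then have "\<alpha> \<noteq> []" "n - a \<noteq> 0" using Cons.prems by auto
    then show ?thesis
      using Cons.IH[of "n - a"] Cons.prems by (force simp: part_sums_Cons)
  qed auto
qed auto

text \<open>The smallest partial sum is the first part; removing it and shifting back reduces to the
  tails.\<close>

lemma part_sums_inj:
  "\<alpha> \<in> Comp n \<Longrightarrow> \<beta> \<in> Comp n \<Longrightarrow> part_sums \<alpha> = part_sums \<beta> \<Longrightarrow> \<alpha> = \<beta>"
proof (induction \<alpha> arbitrary: n \<beta>)
  case Nil
  then show ?case by auto
next
  case (Cons a \<alpha>)
  then have "n \<noteq> 0" by auto
  with Cons.prems obtain b \<beta>' where \<beta>: "\<beta> = b # \<beta>'" by (cases \<beta>) auto
  have ne: "part_sums (c # \<gamma>) \<noteq> {}" if "\<gamma> \<noteq> []" for c \<gamma>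
    using that by (simp add: part_sums_Cons)
  have Min: "Min (part_sums (c # \<gamma>)) = c" if "c # \<gamma> \<in> Comp n" "\<gamma> \<noteq> []" for c \<gamma>
  proof (rule Min_eqI)
    show "finite (part_sums (c # \<gamma>))"
      using part_sums_subset[OF that(1)] finite_subset by blast
  qed (use that in \<open>auto simp: part_sums_Cons\<close>)
  show ?case
  proof (cases "\<alpha> = [] \<or> \<beta>' = []")
    case True
    then have "\<alpha> = []" "\<beta>' = []"
      using ne[of \<alpha> a] ne[of \<beta>' b] Cons.prems(3) unfolding \<beta> by (metis part_sums_single)+
    then show ?thesis using Cons.prems \<beta> by auto
  next
    case False
    then have "a = b"
      using Min[of a \<alpha>] Min[of b \<beta>'] Cons.prems \<beta> by auto
    \<comment> \<open>Since 0 is never a partial sum, the inserted element \<open>a\<close> is new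
      on both sides and can be cancelled.\<close>
    have pos: "0 \<notin> part_sums \<gamma>" if "\<gamma> \<in> Comp (n - a)" for \<gamma>
      using part_sums_subset[OF that] by auto
    have "insert a ((+) a ` part_sums \<alpha>) = insert a ((+) a ` part_sums \<beta>')"
      using Cons.prems(3) False \<open>a = b\<close> \<beta> by (simp add: part_sums_Cons)
    moreover have "a \<notin> (+) a ` part_sums \<alpha>" "a \<notin> (+) a ` part_sums \<beta>'"
      using pos[of \<alpha>] pos[of \<beta>'] Cons.prems \<beta> \<open>a = b\<close> by auto
    ultimately have "(+) a ` part_sums \<alpha> = (+) a ` part_sums \<beta>'"
      by (simp add: insert_ident)
    then have "part_sums \<alpha> = part_sums \<beta>'"
      by (simp add: inj_image_eq_iff)
    then show ?thesis
      using Cons.IH[of "n - a" \<beta>'] Cons.prems \<beta> \<open>a = b\<close> by auto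
  qed
qed

lemma part_sums_surj:
  "S \<subseteq> {1..<n} \<Longrightarrow> \<exists>\<alpha>\<in>Comp n. part_sums \<alpha> = S"
proof (induction n arbitrary: S rule: less_induct)
  case (less n)
  have fin: "finite S" using less.prems finite_subset by blast
  show ?case
  proof (cases "S = {}")
    case True
    then show ?thesis
      by (cases "n = 0") (auto intro!: bexI[of _ "[n]"])
  next
    case False
    define a where "a = Min S"
    have a: "a \<in> S" "\<And>s. s \<in> S \<Longrightarrow> a \<le> s" using False fin by (auto simp: a_def)
    define T where "T = (\<lambda>s. s - a) ` (S - {a})"
    have "T \<subseteq> {1..<n - a}"
      using a less.prems by (force simp: T_def)
    moreover have "0 < a" "a < n" using a less.prems by auto
    ultimately obtain \<alpha> where \<alpha>: "\<alpha> \<in> Comp (n - a)" "part_sums \<alpha> = T"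
      using less.IH[of "n - a" T] by auto
    then have "\<alpha> \<noteq> []" using \<open>a < n\<close> by auto
    then have "part_sums (a # \<alpha>) = S"
      using \<alpha> a by (force simp: part_sums_Cons T_def image_image)
    then show ?thesis using \<alpha> \<open>0 < a\<close> \<open>a < n\<close>
      by (intro bexI[of _ "a # \<alpha>"]) auto
  qed
qed

lemma bij_part_sums: "bij_betw part_sums (Comp n) (Pow {1..<n})"
  unfolding bij_betw_def inj_on_def using part_sums_inj part_sums_surj part_sums_subset by blast

lemma co_props:
  assumes "S \<subseteq> {1..<n}"
  shows co_in_Comp: "co n S \<in> Comp n" and part_sums_co: "part_sums (co n S) = S"
proof -
  have inj: "inj_on part_sums (Comp n)" and S: "S \<in> part_sums ` Comp n"
    using bij_part_sums[of n] assms by (auto simp: bij_betw_def)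
  show "co n S \<in> Comp n"
    unfolding co_def by (rule the_inv_into_into[OF inj S]) auto
  show "part_sums (co n S) = S"
    unfolding co_def by (rule f_the_inv_into_f[OF inj S])
qed

lemma finite_Comp [simp]: "finite (Comp n)"
  using bij_betw_finite[OF bij_part_sums] by simp

lemma one_row_Comp: "one_row n \<in> Comp n" and part_sums_one_row [simp]: "part_sums (one_row n) = {}"
  by (auto simp: one_row_def)

lemma one_col_Comp: "one_col n \<in> Comp n"
  by (auto simp: one_col_def Comp_def sum_list_replicate)

lemma part_sums_one_col: "part_sums (one_col n) = {1..<n}"
proof (rule antisym[OF part_sums_subset[OF one_col_Comp]], rule subsetI)
  fix i assume "i \<in> {1..<n}"
  then show "i \<in> part_sums (one_col n)"
    by (auto simp: part_sums_def one_col_def sum_list_replicate intro!: exI[of _ i])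
qed


section \<open>Quasisymmetric functions as generating functions of words\<close>

definition word_mono :: "nat list \<Rightarrow> mono" where
  "word_mono f = (\<Sum>a\<leftarrow>f. Poly_Mapping.single a 1)"

lemma word_mono_Nil [simp]: "word_mono [] = 0"
  and word_mono_Cons: "word_mono (a # f) = Poly_Mapping.single a 1 + word_mono f"
  and word_mono_append: "word_mono (f @ g) = word_mono f + word_mono g"
  by (simp_all add: word_mono_def)

lemma lookup_word_mono: "Poly_Mapping.lookup (word_mono f) a = count (mset f) a"
  by (induction f) (auto simp: word_mono_Cons lookup_add lookup_single)

lemma word_mono_eq_iff: "word_mono f = word_mono g \<longleftrightarrow> mset f = mset g"
  by (auto simp: poly_mapping_eq_iff multiset_eq_iff lookup_word_mono fun_eq_iff)

lemma word_mono_replicate: "word_mono (replicate k a) = Poly_Mapping.single a k"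
  by (induction k) (auto simp: word_mono_Cons single_add[symmetric])

lemma word_mono_length: "word_mono f = word_mono g \<Longrightarrow> length f = length g"
  by (metis word_mono_eq_iff size_mset)

lemma word_mono_sorted_eq: "word_mono f = word_mono g \<Longrightarrow> sorted f \<Longrightarrow> sorted g \<Longrightarrow> f = g"
  by (metis word_mono_eq_iff properties_for_sort sort_key_id_if_sorted)

text \<open>Words with the same monomial are rearrangements of one another. Finiteness keeps the
  cardinalities below from defaulting to 0.\<close>

lemma finite_word_mono: "finite {f. word_mono f = m \<and> P f}"
proof (cases "\<exists>f. word_mono f = m")
  case True
  then obtain g where "word_mono g = m" ..
  then have "{f. word_mono f = m \<and> P f} \<subseteq> {f. mset f = mset g}"
    by (auto simp: word_mono_eq_iff[symmetric])
  then show ?thesis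
    using finite_subset mset_eq_finite by blast
qed auto

text \<open>Position \<open>i\<close> lies after the first \<open>i\<close> letters. For a sorted
  word, \<open>steps\<close> is therefore the set of partial sums of the lengths of its constant
  runs.\<close>

definition steps :: "nat list \<Rightarrow> nat set" where
  "steps f = {i. 1 \<le> i \<and> i < length f \<and> f ! (i - 1) < f ! i}"

lemma steps_Nil [simp]: "steps [] = {}"
  by (simp add: steps_def)

lemma steps_append:
  assumes "f \<noteq> []" "g \<noteq> []" "last f < hd g"
  shows "steps (f @ g) = steps f \<union> insert (length f) ((+) (length f) ` steps g)" (is "?L = ?R")
proof (rule set_eqI)
  fix i
  consider "i < length f" | "i = length f" | k where "i = length f + k" "k > 0"
    by (metis less_imp_add_positive nat_neq_iff)
  then show "i \<in> ?L \<longleftrightarrow> i \<in> ?R"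
  proof cases
    case 2
    then show ?thesis using assms
      by (auto simp: steps_def nth_append last_conv_nth hd_conv_nth Suc_le_eq)
  next
    case 3
    then have "\<not> i < length f" "i - 1 = length f + (k - 1)" by auto
    then show ?thesis using 3
      by (auto simp: steps_def nth_append)
  qed (auto simp: steps_def nth_append)
qed

lemma steps_replicate [simp]: "steps (replicate k a) = {}"
  by (auto simp: steps_def)

definition expand_word :: "nat list \<Rightarrow> nat list \<Rightarrow> nat list" where
  "expand_word \<alpha> xs = concat (map2 replicate \<alpha> xs)"

lemma expand_word_Cons [simp]: "expand_word (a # \<alpha>) (x # xs) = replicate a x @ expand_word \<alpha> xs"
  and expand_word_Nil [simp]: "expand_word [] xs = []"
  by (simp_all add: expand_word_def)

lemma set_expand_word_subset: "length xs = length \<alpha> \<Longrightarrow> set (expand_word \<alpha> xs) \<subseteq> set xs"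
  by (induction xs \<alpha> rule: list_induct2) auto

lemma word_mono_expand_word:
  "length xs = length \<alpha> \<Longrightarrow>
    word_mono (expand_word \<alpha> xs) = (\<Sum>j<length \<alpha>. Poly_Mapping.single (xs ! j) (\<alpha> ! j))"
proof (induction xs \<alpha> rule: list_induct2)
  case (Cons x xs a \<alpha>)
  then show ?case
    by (simp only: expand_word_Cons word_mono_append word_mono_replicate length_Cons sum.lessThan_Suc_shift
        nth_Cons_0 nth_Cons_Suc o_def)
qed auto

text \<open>A term of \<open>M_\<alpha>\<close>, written out as a weakly increasing word, consists
  of constant runs of lengths \<open>\<alpha>\<close>, and the letter changes exactly at the partial
  sums. The induction splits off the first run.\<close>

lemma bij_expand_word:
  assumes "\<alpha> \<in> Comp n"
  shows "bij_betw (expand_word \<alpha>) {xs. length xs = length \<alpha> \<and> sorted_wrt (<) xs}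
    {f. length f = n \<and> sorted f \<and> steps f = part_sums \<alpha>}"
  using assms
proof (induction \<alpha> arbitrary: n)
  case Nil
  then show ?case
    by (auto simp: bij_betw_def inj_on_def)
next
  case (Cons a \<alpha>)
  define X where "X = (\<lambda>\<alpha>::nat list. {xs :: nat list. length xs = length \<alpha> \<and> sorted_wrt (<) xs})"
  define Y where "Y = (\<lambda>n (\<alpha>::nat list). {f. length f = n \<and> sorted f \<and> steps f = part_sums \<alpha>})"
  have a: "0 < a" "a \<le> n" "\<alpha> \<in> Comp (n - a)" using Cons.prems by auto
  have IH: "bij_betw (expand_word \<alpha>) (X \<alpha>) (Y (n - a) \<alpha>)"
    using Cons.IH[OF a(3)] by (simp add: X_def Y_def)
  have ne: "\<alpha> \<noteq> [] \<longleftrightarrow> n - a > 0" using a by (cases \<alpha>) auto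
  have "bij_betw (expand_word (a # \<alpha>)) (X (a # \<alpha>)) (Y n (a # \<alpha>))"
    unfolding bij_betw_def
  proof (intro conjI)
    show "inj_on (expand_word (a # \<alpha>)) (X (a # \<alpha>))"
    proof (rule inj_onI)
      fix xs ys assume *: "xs \<in> X (a # \<alpha>)" "ys \<in> X (a # \<alpha>)" "expand_word (a # \<alpha>) xs = expand_word (a # \<alpha>) ys"
      obtain x xs' y ys' where xy: "xs = x # xs'" "ys = y # ys'"
        using * by (cases xs; cases ys) (auto simp: X_def)
      have "replicate a x = replicate a y" "expand_word \<alpha> xs' = expand_word \<alpha> ys'"
        using * by (simp_all add: xy)
      moreover have "xs' \<in> X \<alpha>" "ys' \<in> X \<alpha>" using * by (auto simp: X_def xy)
      ultimately show "xs = ys"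
        using IH a(1) xy by (auto simp: bij_betw_def inj_on_def replicate_eq_replicate)
    qed
    have app: "replicate a x @ g \<in> Y n (a # \<alpha>)"
      if "g \<in> Y (n - a) \<alpha>" "\<forall>y\<in>set g. x < y" for x g
    proof (cases "\<alpha> = []")
      case True
      then show ?thesis using that a by (auto simp: Y_def)
    next
      case False
      then have "g \<noteq> []" using that ne by (auto simp: Y_def)
      then have "steps (replicate a x @ g) = insert a ((+) a ` part_sums \<alpha>)"
        using that a by (subst steps_append) (auto simp: Y_def)
      then show ?thesis using that a False
        by (auto simp: Y_def part_sums_Cons sorted_append less_imp_le)
    qed
    show "expand_word (a # \<alpha>) ` X (a # \<alpha>) = Y n (a # \<alpha>)"
    proof (rule antisym; rule subsetI)
      fix f assume "f \<in> expand_word (a # \<alpha>) ` X (a # \<alpha>)"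
      then obtain xs where xs: "xs \<in> X (a # \<alpha>)" "f = expand_word (a # \<alpha>) xs" by auto
      then obtain x xs' where x: "xs = x # xs'" by (cases xs) (auto simp: X_def)
      have "xs' \<in> X \<alpha>" "\<forall>y\<in>set xs'. x < y" using xs by (auto simp: X_def x)
      then show "f \<in> Y n (a # \<alpha>)"
        unfolding xs x expand_word_Cons using IH set_expand_word_subset[of xs' \<alpha>]
        by (intro app) (auto simp: bij_betw_def X_def)
    next
      fix f assume f: "f \<in> Y n (a # \<alpha>)"
      then have len: "length f = n" and srt: "sorted f" and st: "steps f = part_sums (a # \<alpha>)"
        by (auto simp: Y_def)
      define x where "x = f ! 0"
      define g where "g = drop a f"
      have lt: "i \<ge> a" if "i \<in> part_sums (a # \<alpha>)" for i
        using that by (cases "\<alpha> = []") (auto simp: part_sums_Cons)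
      \<comment> \<open>Every step is at position \<open>a\<close> or later, so the first
        \<open>a\<close> letters of the sorted word agree.\<close>
      have const: "i < a \<Longrightarrow> f ! i = x" for i
      proof (induction i)
        case (Suc i)
        have "Suc i \<notin> steps f" using lt Suc.prems unfolding st by force
        then have "f ! Suc i \<le> f ! i"
          using Suc.prems a len by (auto simp: steps_def)
        moreover have "f ! i \<le> f ! Suc i"
          using srt Suc.prems a len by (intro sorted_nth_mono) auto
        ultimately show ?case using Suc by simp
      qed (simp add: x_def)
      have f_eq: "f = replicate a x @ g"
        using len a const by (intro nth_equalityI) (auto simp: nth_append g_def)
      have g: "length g = n - a" "sorted g" using len srt by (auto simp: g_def sorted_wrt_drop)
      have xg: "\<forall>y\<in>set g. x < y"
      proof (cases "\<alpha> = []")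
        case True
        then show ?thesis using g ne by auto
      next
        case False
        then have "a \<in> steps f" using st by (simp add: part_sums_Cons)
        then have "x < f ! a" using const[of "a - 1"] a by (auto simp: steps_def)
        also have "f ! a = hd g" using False ne len by (simp add: g_def hd_drop_conv_nth)
        finally show ?thesis using g(2) by (cases g) auto
      qed
      have "steps g = part_sums \<alpha>"
      proof (cases "\<alpha> = []")
        case True
        then show ?thesis using g ne by auto
      next
        case False
        then have "g \<noteq> []" using g ne by auto
        then have "insert a ((+) a ` steps g) = insert a ((+) a ` part_sums \<alpha>)"
          using st False a xg unfolding f_eq by (simp add: steps_append part_sums_Cons)
        moreover have "a \<notin> (+) a ` steps g" "a \<notin> (+) a ` part_sums \<alpha>"
          using part_sums_subset[OF a(3)] by (auto simp: steps_def)
        ultimately have "(+) a ` steps g = (+) a ` part_sums \<alpha>"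
          by (simp add: insert_ident)
        then show ?thesis by (simp add: inj_image_eq_iff)
      qed
      then have "g \<in> Y (n - a) \<alpha>" using g by (auto simp: Y_def)
      then obtain xs where xs: "xs \<in> X \<alpha>" "g = expand_word \<alpha> xs"
        using IH by (auto simp: bij_betw_def)
      \<comment> \<open>Parts are positive, so every letter of \<open>xs\<close> survives in the
        expanded word and the bound on \<open>g\<close> applies to it.\<close>
      have "\<forall>y\<in>set xs. x < y"
      proof -
        have "set (expand_word \<alpha> xs) = set xs" if "length xs = length \<alpha>" "\<forall>a\<in>set \<alpha>. 0 < a"
          for xs \<alpha> using that by (induction xs \<alpha> rule: list_induct2) auto
        then show ?thesis using xg xs a by (auto simp: X_def Comp_def)
      qed
      then show "f \<in> expand_word (a # \<alpha>) ` X (a # \<alpha>)"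
        using xs f_eq by (intro image_eqI[of _ _ "x # xs"]) (auto simp: X_def)
    qed
  qed
  then show ?case by (simp add: X_def Y_def)
qed

lemma QM_eq_card:
  assumes "\<alpha> \<in> Comp n"
  shows "QM \<alpha> m = of_nat (card {f. length f = n \<and> sorted f \<and> steps f = part_sums \<alpha> \<and> word_mono f = m})"
proof -
  have "bij_betw (expand_word \<alpha>) {xs. length xs = length \<alpha> \<and> sorted_wrt (<) xs \<and> word_mono (expand_word \<alpha> xs) = m}
      {f. length f = n \<and> sorted f \<and> steps f = part_sums \<alpha> \<and> word_mono f = m}"
    using bij_betw_Collect[OF bij_expand_word[OF assms], of "\<lambda>f. word_mono f = m" "\<lambda>xs. word_mono (expand_word \<alpha> xs) = m"]
    by simp
  moreover have "{xs. length xs = length \<alpha> \<and> sorted_wrt (<) xs \<and> word_mono (expand_word \<alpha> xs) = m}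
     = {xs. length xs = length \<alpha> \<and> sorted_wrt (<) xs \<and>
     (\<Sum>j<length \<alpha>. Poly_Mapping.single (xs ! j) (\<alpha> ! j)) = m}"
    using word_mono_expand_word by auto
  ultimately show ?thesis
    unfolding QM_def by (simp add: bij_betw_same_card)
qed

text \<open>
  Generating function of the words of length \<open>n\<close> that increase weakly at the positions outside \<open>S\<close>,
  and strictly at those in \<open>D\<close>; position \<open>i\<close> compares the \<open>i\<close>-th and the \<open>(i+1)\<close>-st letter.
\<close>

definition word_gf :: "nat \<Rightarrow> nat set \<Rightarrow> nat set \<Rightarrow> pser" where
  "word_gf n D S m = of_nat (card {f. length f = n \<and> word_mono f = m \<and>
     (\<forall>i\<in>{1..<n} - S. f ! (i - 1) \<le> f ! i \<and> (i \<in> D \<longrightarrow> f ! (i - 1) < f ! i))})"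

abbreviation F :: "nat \<Rightarrow> nat set \<Rightarrow> pser" where
  "F n D \<equiv> word_gf n D {}"

lemma word_gf_cong: "D \<inter> {1..<n} = D' \<inter> {1..<n} \<Longrightarrow> S \<inter> {1..<n} = S' \<inter> {1..<n} \<Longrightarrow> word_gf n D S = word_gf n D' S'"
proof -
  assume "D \<inter> {1..<n} = D' \<inter> {1..<n}" and S: "S \<inter> {1..<n} = S' \<inter> {1..<n}"
  then have "i \<in> D \<longleftrightarrow> i \<in> D'" if "i \<in> {1..<n}" for i using that by blast
  moreover have "{1..<n} - S = {1..<n} - S'" using S by blast
  ultimately show ?thesis
    unfolding word_gf_def by (intro ext) (metis (no_types, lifting) DiffD1)
qed

lemma sorted_iff_nth_pred:
  "sorted f \<longleftrightarrow> (\<forall>i\<in>{1..<length f}. f ! (i - 1) \<le> f ! i)"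
  unfolding sorted_iff_nth_Suc
  by (metis (no_types, lifting) atLeastLessThan_iff diff_Suc_1 le_add1 plus_1_eq_Suc Suc_pred' Suc_le_eq One_nat_def)

lemma F_eq_card:
  "F n D m = of_nat (card {f. length f = n \<and> sorted f \<and> D \<inter> {1..<n} \<subseteq> steps f \<and> word_mono f = m})"
  unfolding word_gf_def steps_def sorted_iff_nth_pred
  by (intro arg_cong[where f = of_nat] arg_cong[where f = card] Collect_cong) auto

text \<open>
  The coefficient of \<open>M\<^sub>\<beta>\<close> in a quasisymmetric function is its value at the exponent vector of
  \<open>x\<^sub>0^b\<^sub>1 x\<^sub>1^b\<^sub>2 \<cdots>\<close>, which is \<open>packed_mono n S\<close> for \<open>S\<close> the set of partial sums of \<open>\<beta>\<close>.
\<close>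
definition packed_mono :: "nat \<Rightarrow> nat set \<Rightarrow> mono" where
  "packed_mono n S = word_mono (map (\<lambda>i. card (S \<inter> {..i})) [0..<n])"

abbreviation mon :: "nat list \<Rightarrow> mono" where
  "mon \<alpha> \<equiv> packed_mono (sum_list \<alpha>) (part_sums \<alpha>)"

text \<open>The letter at index \<open>i\<close> counts the elements of \<open>S\<close> up to
  \<open>i\<close>, so it grows by one exactly on reaching an element of \<open>S\<close>.\<close>

lemma packed_mono_word:
  assumes "S \<subseteq> {1..<n}"
  defines "f \<equiv> map (\<lambda>i. card (S \<inter> {..i})) [0..<n]"
  shows "sorted f" "steps f = S"
proof -
  show "sorted f"
    unfolding sorted_iff_nth_mono by (auto simp: f_def intro!: card_mono)
  have "card (S \<inter> {..i - Suc 0}) < card (S \<inter> {..i}) \<longleftrightarrow> i \<in> S" if "i \<ge> 1" "i < n" for i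
  proof -
    have "{..i} = insert i {..i - Suc 0}" using that by auto
    then have "S \<inter> {..i} = (if i \<in> S then insert i (S \<inter> {..i - Suc 0}) else S \<inter> {..i - Suc 0})"
      by auto
    then show ?thesis using that by auto
  qed
  then show "steps f = S"
    using assms by (force simp: steps_def f_def)
qed

lemma sorted_word_mono_packed_mono:
  assumes "S \<subseteq> {1..<n}" "sorted f" "word_mono f = packed_mono n S"
  shows "f = map (\<lambda>i. card (S \<inter> {..i})) [0..<n]"
  using assms packed_mono_word(1) word_mono_sorted_eq unfolding packed_mono_def by blast

lemma packed_mono_empty: "packed_mono n {} = Poly_Mapping.single 0 n"
  by (simp add: packed_mono_def map_replicate_const word_mono_replicate)

lemma subset_singleton_if: "A \<subseteq> {a} \<Longrightarrow> a \<in> A \<longleftrightarrow> P \<Longrightarrow> A = (if P then {a} else {})"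
  by auto

text \<open>A sorted word is determined by its monomial, and its steps and length give the
  composition back. Thus the points \<open>mon \<beta>\<close> are dual to the monomial
  basis.\<close>

lemma QM_mon:
  assumes "\<alpha> \<in> Comps" "\<beta> \<in> Comps"
  shows "QM \<alpha> (mon \<beta>) = (if \<alpha> = \<beta> then 1 else 0)"
proof -
  define g where "g = map (\<lambda>i. card (part_sums \<beta> \<inter> {..i})) [0..<sum_list \<beta>]"
  have \<beta>: "part_sums \<beta> \<subseteq> {1..<sum_list \<beta>}" and \<alpha>: "\<alpha> \<in> Comp (sum_list \<alpha>)"
    using assms part_sums_subset[of \<beta>] unfolding in_Comps_iff by blast+
  have g: "sorted g" "steps g = part_sums \<beta>" "length g = sum_list \<beta>" "word_mono g = mon \<beta>"
    using packed_mono_word[OF \<beta>] by (auto simp: g_def packed_mono_def)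
  have "{f. length f = sum_list \<alpha> \<and> sorted f \<and> steps f = part_sums \<alpha> \<and> word_mono f = mon \<beta>}
     = (if \<alpha> = \<beta> then {g} else {})"
  proof (rule subset_singleton_if, rule subsetI)
    fix f assume "f \<in> {f. length f = sum_list \<alpha> \<and> sorted f \<and> steps f = part_sums \<alpha> \<and> word_mono f = mon \<beta>}"
    then show "f \<in> {g}" using sorted_word_mono_packed_mono[OF \<beta>, folded g_def, of f] by simp
  next
    have "\<alpha> = \<beta>" if "sum_list \<beta> = sum_list \<alpha>" "part_sums \<beta> = part_sums \<alpha>"
      using part_sums_inj[OF \<alpha>, of \<beta>] assms(2) that unfolding in_Comps_iff by metis
    then show "g \<in> {f. length f = sum_list \<alpha> \<and> sorted f \<and> steps f = part_sums \<alpha> \<and> word_mono f = mon \<beta>} \<longleftrightarrow> \<alpha> = \<beta>"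
      unfolding mem_Collect_eq g(2,3,4) using g(1) by (metis (lifting))
  qed
  then show ?thesis
    unfolding QM_eq_card[OF \<alpha>] by simp
qed

text \<open>Only the packed word itself can contribute, so the values of the \<open>F\<close> are
  the incidence matrix of inclusion: unitriangular rather than dual.\<close>

lemma F_packed_mono:
  assumes "S \<subseteq> {1..<n}"
  shows "F n D (packed_mono n S) = (if D \<inter> {1..<n} \<subseteq> S then 1 else 0)"
proof -
  define g where "g = map (\<lambda>i. card (S \<inter> {..i})) [0..<n]"
  have g: "sorted g" "steps g = S" "length g = n" "word_mono g = packed_mono n S"
    using packed_mono_word[OF assms] by (auto simp: g_def packed_mono_def)
  have "{f. length f = n \<and> sorted f \<and> D \<inter> {1..<n} \<subseteq> steps f \<and> word_mono f = packed_mono n S}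
     = (if D \<inter> {1..<n} \<subseteq> S then {g} else {})"
    (is "?L = _")
  proof -
    have "?L \<subseteq> {g}"
      using sorted_word_mono_packed_mono[OF assms, folded g_def] by blast
    moreover have "g \<in> ?L \<longleftrightarrow> D \<inter> {1..<n} \<subseteq> S"
      unfolding mem_Collect_eq g(2) using g(1,3,4) by simp
    ultimately show ?thesis by (rule subset_singleton_if)
  qed
  then show ?thesis
    unfolding F_eq_card by simp
qed

text \<open>The sorted words counted by \<open>F\<close> are classified by their exact set of
  steps.\<close>

lemma F_eq_sum_QM: "F n D = (\<Sum>\<beta>\<in>{\<beta> \<in> Comp n. D \<inter> {1..<n} \<subseteq> part_sums \<beta>}. QM \<beta>)"
proof
  fix m
  let ?Y = "\<lambda>T. {f. length f = n \<and> sorted f \<and> steps f = T \<and> word_mono f = m}"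
  let ?C = "{\<beta> \<in> Comp n. D \<inter> {1..<n} \<subseteq> part_sums \<beta>}"
  have "{f. length f = n \<and> sorted f \<and> D \<inter> {1..<n} \<subseteq> steps f \<and> word_mono f = m}
      = (\<Union>\<beta>\<in>?C. ?Y (part_sums \<beta>))" (is "?L = ?R")
  proof
    show "?L \<subseteq> ?R"
    proof
      fix f assume f: "f \<in> ?L"
      then have "steps f \<subseteq> {1..<n}" by (auto simp: steps_def)
      then obtain \<beta> where "\<beta> \<in> Comp n" "part_sums \<beta> = steps f"
        using part_sums_surj by blast
      then show "f \<in> ?R" using f by auto
    qed
  qed auto
  moreover have "card (\<Union>\<beta>\<in>?C. ?Y (part_sums \<beta>)) = (\<Sum>\<beta>\<in>?C. card (?Y (part_sums \<beta>)))"
  proof (rule card_UN_disjoint)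
    show "\<forall>\<beta>\<in>?C. finite (?Y (part_sums \<beta>))"
      using finite_word_mono by (auto intro: finite_subset[OF _ finite_word_mono[of m "\<lambda>_. True"]])
      show "\<forall>\<beta>\<in>?C. \<forall>\<gamma>\<in>?C. \<beta> \<noteq> \<gamma> \<longrightarrow> ?Y (part_sums \<beta>) \<inter> ?Y (part_sums \<gamma>) = {}"
      using part_sums_inj by fastforce
  qed simp
  ultimately show "F n D m = (\<Sum>\<beta>\<in>?C. QM \<beta>) m"
    unfolding F_eq_card sum_fun_apply by (simp add: QM_eq_card[of _ n])
qed

lemma QF_eq_F: "\<alpha> \<in> Comp n \<Longrightarrow> QF \<alpha> = F n (part_sums \<alpha>)"
  using part_sums_subset[of \<alpha> n] unfolding QF_def F_eq_sum_QM
  by (simp add: sum_list_Comp Int_absorb2)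

section \<open>Homogeneous components and their coefficients\<close>

lemma QM_Qdeg: "\<alpha> \<in> Comp n \<Longrightarrow> QM \<alpha> \<in> Qdeg n"
  unfolding Qdeg_def by (auto intro: fvs.span_base)

lemma F_Qdeg: "F n D \<in> Qdeg n"
  unfolding F_eq_sum_QM Qdeg_def by (intro fvs.span_sum fvs.span_base) auto

lemma Qdeg_QSym: "Qdeg n \<subseteq> QSym"
  unfolding Qdeg_def QSym_def by (intro fvs.span_mono) (auto simp: Comps_def)

lemma Qdeg_expand:
  assumes "v \<in> Qdeg n"
  shows "v = (\<Sum>\<alpha>\<in>Comp n. fscale (v (mon \<alpha>)) (QM \<alpha>))"
proof -
  obtain J c where J: "finite J" "J \<subseteq> Comp n" "v = (\<Sum>j\<in>J. fscale (c j) (QM j))"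
    using span_family_finite_sum[OF assms[unfolded Qdeg_def]] .
  have c: "v (mon \<alpha>) = (if \<alpha> \<in> J then c \<alpha> else 0)" if "\<alpha> \<in> Comp n" for \<alpha>
  proof -
    have "v (mon \<alpha>) = (\<Sum>j\<in>J. if j = \<alpha> then c \<alpha> else 0)"
      unfolding J sum_fun_apply fscale_apply using J that
      by (intro sum.cong) (auto simp: QM_mon Comp_Comps subset_iff)
    then show ?thesis using J by simp
  qed
  have "(\<Sum>\<alpha>\<in>Comp n. fscale (v (mon \<alpha>)) (QM \<alpha>)) = (\<Sum>\<alpha>\<in>Comp n. if \<alpha> \<in> J then fscale (c \<alpha>) (QM \<alpha>) else 0)"
    by (intro sum.cong) (auto simp: c)
  also have "\<dots> = v"
    unfolding J(3) using J(2) by (simp add: sum.If_cases Int_absorb1)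
  finally show ?thesis ..
qed

lemma Qdeg_eqI:
  assumes "v \<in> Qdeg n" "w \<in> Qdeg n" "\<And>S. S \<subseteq> {1..<n} \<Longrightarrow> v (packed_mono n S) = w (packed_mono n S)"
  shows "v = w"
proof -
  have "v (mon \<alpha>) = w (mon \<alpha>)" if "\<alpha> \<in> Comp n" for \<alpha>
    using assms(3)[OF part_sums_subset[OF that]] that by (simp add: sum_list_Comp)
  then show ?thesis
    using Qdeg_expand[OF assms(1)] Qdeg_expand[OF assms(2)] by (metis (no_types, lifting) sum.cong)
qed

lemma Qdeg_eval_other_degree:
  assumes "v \<in> Qdeg n" "k \<noteq> n"
  shows "v (packed_mono k S) = 0"
proof -
  have "QM \<alpha> (packed_mono k S) = 0" if "\<alpha> \<in> Comp n" for \<alpha>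
    unfolding QM_eq_card[OF that] packed_mono_def using assms(2)
    by (auto simp: card_eq_0_iff dest: word_mono_length)
  then show ?thesis
    by (subst Qdeg_expand[OF assms(1)]) (simp add: sum_fun_apply fscale_apply)
qed


section \<open>Products\<close>

text \<open>This gives the sum in \<open>ps_mult\<close> its meaning. A split is determined by
  \<open>u\<close>, whose exponents are bounded by those of \<open>m\<close>.\<close>

lemma finite_mono_splits: "finite {(u, v). u + v = (m :: mono)}"
proof -
  have "(\<lambda>(u, v). Poly_Mapping.lookup u) ` {(u, v). u + v = m} \<subseteq>
      {h. \<forall>k. h k \<le> Poly_Mapping.lookup m k}"
    by (auto simp: lookup_add)
  moreover have "finite {h. \<forall>k. h k \<le> Poly_Mapping.lookup m k}"
  proof -
    have "{h. \<forall>k. h k \<le> Poly_Mapping.lookup m k} \<subseteq>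
        {h. \<forall>k. (k \<in> Poly_Mapping.keys m \<longrightarrow> h k \<in> {..\<Sum>k\<in>Poly_Mapping.keys m. Poly_Mapping.lookup m k})
          \<and> (k \<notin> Poly_Mapping.keys m \<longrightarrow> h k = 0)}"
    proof (rule subsetI, rule CollectI, intro allI conjI impI)
      fix h k assume h: "h \<in> {h. \<forall>k. h k \<le> Poly_Mapping.lookup m k}"
      show "h k = 0" if "k \<notin> Poly_Mapping.keys m"
        using h that by (metis in_keys_iff le_zero_eq mem_Collect_eq)
      assume "k \<in> Poly_Mapping.keys m"
      then have "Poly_Mapping.lookup m k \<le> (\<Sum>k\<in>Poly_Mapping.keys m. Poly_Mapping.lookup m k)"
        by (intro member_le_sum) auto
      then show "h k \<in> {..\<Sum>k\<in>Poly_Mapping.keys m. Poly_Mapping.lookup m k}"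
        using h by (auto intro: order_trans)
    qed
    then show ?thesis
      by (rule finite_subset) (intro finite_set_of_finite_funs; simp)
  qed
  moreover have "inj_on (\<lambda>(u, v). Poly_Mapping.lookup u) {(u, v). u + v = m}"
    by (auto simp: inj_on_def poly_mapping.lookup_inject)
  ultimately show ?thesis
    using finite_imageD finite_subset by blast
qed

text \<open>Multiplication is concatenation of words. No condition links the last letter of the
  first word to the first letter of the second, so the seam \<open>b\<close> becomes a free
  position, and the positions of the second word move up by \<open>b\<close>.\<close>

lemma ps_mult_word_gf:
  assumes "0 < b" "0 < j"
  shows "ps_mult (F b D) (word_gf j {d. d + b \<in> D} S) = word_gf (b + j) D (insert b ((+) b ` S))"
proof
  fix m
  define ok where "ok = (\<lambda>n D S (f :: nat list). \<forall>i\<in>{1..<n} - S. f ! (i - 1) \<le> f ! i \<and> (i \<in> D \<longrightarrow> f ! (i - 1) < f ! i))"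
  define A where "A = (\<lambda>n D S m. {f. length f = n \<and> word_mono f = m \<and> ok n D S f})"
  have word_gf: "word_gf n D S m = of_nat (card (A n D S m))" for n D S m
    by (simp add: word_gf_def A_def ok_def)
  have finA: "finite (A n D S m)" for n D S m
    by (rule finite_subset[OF _ finite_word_mono[of m "\<lambda>_. True"]]) (auto simp: A_def)
  let ?D = "{d. d + b \<in> D}" and ?S = "insert b ((+) b ` S)"
  have ok_append: "ok (b + j) D ?S (f @ g) \<longleftrightarrow> ok b D {} f \<and> ok j ?D S g"
    if "length f = b" "length g = j" for f g
  proof -
    have split: "{1..<b + j} - ?S = {1..<b} \<union> (+) b ` ({1..<j} - S)"
    proof (intro set_eqI)
      fix i
      show "i \<in> {1..<b + j} - ?S \<longleftrightarrow> i \<in> {1..<b} \<union> (+) b ` ({1..<j} - S)"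
      proof (cases "i \<le> b")
        case True
        then show ?thesis using assms by (auto)
      next
        case False
        then obtain k where "i = b + k" "0 < k" by (metis less_imp_add_positive not_le)
        then show ?thesis by auto
      qed
    qed
    have "(f @ g) ! (i - 1) = f ! (i - 1)" "(f @ g) ! i = f ! i" if "i \<in> {1..<b}" for i
      using that \<open>length f = b\<close> by (auto simp: nth_append)
    moreover have "(f @ g) ! (b + i - 1) = g ! (i - 1)" "(f @ g) ! (b + i) = g ! i"
      if "i \<in> {1..<j} - S" for i
      using that \<open>length f = b\<close> by (auto simp: nth_append)
    ultimately show ?thesis
      unfolding ok_def split ball_Un ball_simps by (simp add: add.commute)
  qed
  have "A (b + j) D ?S m = (\<lambda>(f, g). f @ g) ` (\<Union>(u, v)\<in>{(u, v). u + v = m}. A b D {} u \<times> A j ?D S v)"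
    (is "?L = _ ` ?R")
  proof (intro antisym subsetI)
    fix f assume f: "f \<in> ?L"
    then have len: "length (take b f) = b" "length (drop b f) = j" by (auto simp: A_def)
    have "ok b D {} (take b f) \<and> ok j ?D S (drop b f)"
      using f ok_append[OF len] by (auto simp: A_def)
    moreover have "word_mono (take b f) + word_mono (drop b f) = m"
      using f word_mono_append[of "take b f" "drop b f"] by (auto simp: A_def)
    ultimately have "(take b f, drop b f) \<in> ?R"
      using len by (auto simp: A_def)
    then show "f \<in> (\<lambda>(f, g). f @ g) ` ?R"
      by (intro image_eqI[of _ _ "(take b f, drop b f)"]) simp_all
  next
    fix f assume "f \<in> (\<lambda>(f, g). f @ g) ` ?R"
    then show "f \<in> ?L" using ok_append by (auto simp: A_def word_mono_append)
  qed
  moreover have "inj_on (\<lambda>(f, g). f @ g) ?R"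
    by (auto simp: inj_on_def A_def)
  ultimately have "card ?L = card ?R" by (simp add: card_image)
  also have "\<dots> = (\<Sum>(u, v)\<in>{(u, v). u + v = m}. card (A b D {} u \<times> A j ?D S v))"
    using finA finite_mono_splits[of m]
    by (subst card_UN_disjoint) (auto simp: split_beta A_def)
  finally show "ps_mult (F b D) (word_gf j ?D S) m = word_gf (b + j) D ?S m"
    unfolding ps_mult_def word_gf by (simp add: card_cartesian_product split_beta)
qed

text \<open>Setting all variables but \<open>x\<^sub>0\<close> to 0 is multiplicative: a power of
  \<open>x\<^sub>0\<close> splits only into powers of \<open>x\<^sub>0\<close>, and homogeneity
  leaves the single split into degrees \<open>i\<close> and \<open>j\<close>.\<close>

lemma ps_mult_single_Qdeg:
  assumes "f \<in> Qdeg i" "g \<in> Qdeg j"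
  shows "ps_mult f g (packed_mono (i + j) {}) = f (packed_mono i {}) * g (packed_mono j {})"
proof -
  let ?s = "Poly_Mapping.single (0::nat)"
  have uv: "u = ?s (Poly_Mapping.lookup u 0) \<and> v = ?s (Poly_Mapping.lookup v 0)"
    if "u + v = ?s (i + j)" for u v :: mono
  proof -
    have *: "Poly_Mapping.lookup u k + Poly_Mapping.lookup v k = (if k = 0 then i + j else 0)" for k
      using that[symmetric] by (metis lookup_add lookup_single_eq lookup_single_not_eq)
    show ?thesis
    proof (intro conjI poly_mapping_eqI)
      show "Poly_Mapping.lookup u k = Poly_Mapping.lookup (?s (Poly_Mapping.lookup u 0)) k" for k
        using *[of k] by (cases "k = 0") (simp_all add: lookup_single)
      show "Poly_Mapping.lookup v k = Poly_Mapping.lookup (?s (Poly_Mapping.lookup v 0)) k" for k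
        using *[of k] by (cases "k = 0") (simp_all add: lookup_single)
    qed
  qed
  have f0: "f (?s k) = 0" if "k \<noteq> i" for k
    using Qdeg_eval_other_degree[OF assms(1) that, of "{}"] by (simp add: packed_mono_empty)
  have "ps_mult f g (?s (i + j)) = (\<Sum>(u, v)\<in>{(?s i, ?s j)}. f u * g v)"
    unfolding ps_mult_def
  proof (rule sum.mono_neutral_right[OF finite_mono_splits])
    show "{(?s i, ?s j)} \<subseteq> {(u, v). u + v = ?s (i + j)}"
      by (simp add: single_add)
    have nz: "f u * g v = 0" if *: "u + v = ?s (i + j)" "(u, v) \<noteq> (?s i, ?s j)" for u v
    proof (cases "Poly_Mapping.lookup u 0 = i")
      case True
      then have "Poly_Mapping.lookup v 0 = j"
        using *(1) by (metis add_left_cancel lookup_add lookup_single_eq)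
      then show ?thesis using uv[OF *(1)] True *(2) by auto
    next
      case False
      then show ?thesis using uv[OF *(1)] f0 by (metis mult_zero_left)
    qed
    show "\<forall>p\<in>{(u, v). u + v = ?s (i + j)} - {(?s i, ?s j)}. (case p of (u, v) \<Rightarrow> f u * g v) = 0"
    proof
      fix p assume "p \<in> {(u, v). u + v = ?s (i + j)} - {(?s i, ?s j)}"
      then show "(case p of (u, v) \<Rightarrow> f u * g v) = 0"
        using nz[of "fst p" "snd p"] unfolding split_beta by (simp del: mult_eq_0_iff)
    qed
  qed
  then show ?thesis by (simp add: packed_mono_empty)
qed


section \<open>Standardization of words\<close>

definition Des :: "nat \<Rightarrow> (nat \<Rightarrow> nat) \<Rightarrow> nat set" where
  "Des n \<sigma> = {i. 1 \<le> i \<and> i < n \<and> \<sigma> i > \<sigma> (i + 1)}"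

lemma Des_subset: "Des n \<sigma> \<subseteq> {1..<n}"
  by (auto simp: Des_def)

lemma Dcomp_eq_co: "Dcomp n \<sigma> = co n (Des n \<sigma>)"
  by (simp add: Dcomp_def Des_def)

lemma Dcomp_in_Comp: "Dcomp n \<sigma> \<in> Comp n"
  and part_sums_Dcomp: "part_sums (Dcomp n \<sigma>) = Des n \<sigma>"
  unfolding Dcomp_eq_co using co_in_Comp[OF Des_subset] part_sums_co[OF Des_subset] by blast+

lemma Dcomp_eq_iff: "\<alpha> \<in> Comp n \<Longrightarrow> Dcomp n \<sigma> = \<alpha> \<longleftrightarrow> Des n \<sigma> = part_sums \<alpha>"
  using part_sums_inj[OF Dcomp_in_Comp[of n \<sigma>], of \<alpha>] part_sums_Dcomp[of n \<sigma>] by metis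

lemma QF_Dcomp: "QF (Dcomp n \<sigma>) = F n (Des n \<sigma>)"
  using QF_eq_F[OF Dcomp_in_Comp] by (simp add: part_sums_Dcomp)

text \<open>Built from the last position backwards: placing the minimum of the available values
  forces a descent before it, placing the maximum forbids one. The offset \<open>a\<close> and the
  arbitrary value set \<open>A\<close> allow separate arrangements on the two sides of a prescribed
  entry.\<close>

lemma ex_arrangement_with_descents:
  fixes A :: "nat set"
  assumes "finite A" "card A = m"
  shows "\<exists>g. bij_betw g {a..<a + m} A \<and> (\<forall>i. a \<le> i \<longrightarrow> i + 1 < a + m \<longrightarrow> (g (i + 1) < g i \<longleftrightarrow> i \<in> S))"
  using assms
proof (induction m arbitrary: A)
  case (Suc m)
  have "A \<noteq> {}" using Suc.prems by auto
  define x where "x = (if a + m - 1 \<in> S then Min A else Max A)"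
  have x: "x \<in> A" using Suc.prems \<open>A \<noteq> {}\<close> by (simp add: x_def)
  have lt: "y < x \<longleftrightarrow> a + m - 1 \<notin> S" "x < y \<longleftrightarrow> a + m - 1 \<in> S" if "y \<in> A - {x}" for y
  proof -
    have "Min A \<le> y" "y \<le> Max A" using that Suc.prems(1) by auto
    then show "y < x \<longleftrightarrow> a + m - 1 \<notin> S" "x < y \<longleftrightarrow> a + m - 1 \<in> S"
      using that by (auto simp: x_def)
  qed
  obtain g where g: "bij_betw g {a..<a + m} (A - {x})"
    "\<And>i. a \<le> i \<Longrightarrow> i + 1 < a + m \<Longrightarrow> g (i + 1) < g i \<longleftrightarrow> i \<in> S"
    using Suc.IH[of "A - {x}"] Suc.prems x by auto
  define h where "h = g(a + m := x)"
  have "bij_betw h {a..<a + m} (A - {x})"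
    using g(1) by (rule bij_betw_cong[THEN iffD1, rotated]) (auto simp: h_def)
  then have "bij_betw h ({a..<a + m} \<union> {a + m}) ((A - {x}) \<union> {h (a + m)})"
    by (intro notIn_Un_bij_betw) (auto simp: h_def)
  moreover have "{a..<a + m} \<union> {a + m} = {a..<a + Suc m}" "(A - {x}) \<union> {h (a + m)} = A"
    using x by (auto simp: h_def)
  ultimately have "bij_betw h {a..<a + Suc m} A" by simp
  moreover have "h (i + 1) < h i \<longleftrightarrow> i \<in> S" if i: "a \<le> i" "i + 1 < a + Suc m" for i
  proof (cases "i + 1 < a + m")
    case True
    then show ?thesis using g(2)[of i] i by (simp add: h_def)
  next
    case False
    then have "i + 1 = a + m" "i = a + m - 1" using i by auto
    moreover have "g i \<in> A - {x}"
      using g(1) i \<open>i + 1 = a + m\<close> by (auto simp: bij_betw_def)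
    ultimately show ?thesis using lt(2)[of "g i"] by (simp add: h_def)
  qed
  ultimately show ?case by blast
qed (auto simp: bij_betw_def)

lemma ex_permutes_Des:
  assumes "S \<subseteq> {1..<n}"
  shows "\<exists>\<sigma>. \<sigma> permutes {1..n} \<and> Des n \<sigma> = S"
proof -
  obtain g where g: "bij_betw g {1..<1 + n} {1..n}" "\<And>i. 1 \<le> i \<Longrightarrow> i + 1 < 1 + n \<Longrightarrow> g (i + 1) < g i \<longleftrightarrow> i \<in> S"
    using ex_arrangement_with_descents[of "{1..n}" n 1 S] by auto
  define \<sigma> where "\<sigma> = (\<lambda>i. if i \<in> {1..n} then g i else i)"
  have "bij_betw g {1..n} {1..n}"
    using g(1) by (simp add: atLeastLessThanSuc_atLeastAtMost)
  then have "bij_betw \<sigma> {1..n} {1..n}"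
    by (rule bij_betw_cong[THEN iffD1, rotated]) (auto simp: \<sigma>_def)
  then have "\<sigma> permutes {1..n}"
    by (rule bij_imp_permutes) (auto simp: \<sigma>_def)
  moreover have "Des n \<sigma> = S"
    using g(2) assms by (auto simp: Des_def \<sigma>_def)
  ultimately show ?thesis by blast
qed

lemma permutes_eq_card:
  assumes "\<tau> permutes {1..n::nat}" "i \<in> {1..n}"
  shows "\<tau> i = card {j \<in> {1..n}. \<tau> j \<le> \<tau> i}"
proof -
  have "\<tau> ` {j \<in> {1..n}. \<tau> j \<le> \<tau> i} = {1..\<tau> i}"
  proof (intro antisym subsetI)
    fix y assume y: "y \<in> {1..\<tau> i}"
    then have "y \<in> {1..n}" using permutes_in_image[OF assms(1), of i] assms(2) by auto
    then obtain j where "j \<in> {1..n}" "y = \<tau> j"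
      using permutes_image[OF assms(1)] by blast
    then show "y \<in> \<tau> ` {j \<in> {1..n}. \<tau> j \<le> \<tau> i}" using y by auto
  qed (use permutes_in_image[OF assms(1)] in auto)
  moreover have "inj_on \<tau> {j \<in> {1..n}. \<tau> j \<le> \<tau> i}"
    using permutes_inj_on[OF assms(1)] .
  ultimately show ?thesis
    by (metis card_atLeastAtMost card_image diff_Suc_1)
qed

text \<open>This is standardization: \<open>\<tau> i\<close> can only be the rank of
  \<open>k i\<close> among the values of \<open>k\<close>.\<close>

lemma ex1_ranking:
  fixes k :: "nat \<Rightarrow> nat"
  assumes inj: "inj_on k {1..n}"
  shows "\<exists>!\<tau>. \<tau> permutes {1..n} \<and> (\<forall>i\<in>{1..n}. \<forall>j\<in>{1..n}. \<tau> i < \<tau> j \<longleftrightarrow> k i < k j)"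
proof (rule ex_ex1I)
  define \<tau> where "\<tau> = (\<lambda>i. if i \<in> {1..n} then card {j \<in> {1..n}. k j \<le> k i} else i)"
  have mono: "\<tau> i < \<tau> j" if "i \<in> {1..n}" "j \<in> {1..n}" "k i < k j" for i j
  proof -
    have "card {l \<in> {1..n}. k l \<le> k i} < card {l \<in> {1..n}. k l \<le> k j}"
    proof (rule psubset_card_mono)
      have "{l \<in> {1..n}. k l \<le> k i} \<subseteq> {l \<in> {1..n}. k l \<le> k j}" using that by auto
      moreover have "j \<in> {l \<in> {1..n}. k l \<le> k j} - {l \<in> {1..n}. k l \<le> k i}" using that by auto
      ultimately show "{l \<in> {1..n}. k l \<le> k i} \<subset> {l \<in> {1..n}. k l \<le> k j}" by blast
    qed auto
    then show ?thesis using that by (simp add: \<tau>_def)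
  qed
  have iff: "\<tau> i < \<tau> j \<longleftrightarrow> k i < k j" if "i \<in> {1..n}" "j \<in> {1..n}" for i j
    using mono[OF that] mono[OF that(2,1)] inj_onD[OF inj _ that] 
    by (metis less_asym linorder_less_linear less_irrefl)
  have "inj_on \<tau> {1..n}"
    using iff inj unfolding inj_on_def by (metis nat_neq_iff)
  moreover have "\<tau> ` {1..n} \<subseteq> {1..n}"
  proof
    fix y assume "y \<in> \<tau> ` {1..n}"
    then obtain i where i: "i \<in> {1..n}" "y = card {j \<in> {1..n}. k j \<le> k i}" by (auto simp: \<tau>_def)
    have "card {j \<in> {1..n}. k j \<le> k i} \<le> card {1..n}" by (intro card_mono) auto
    moreover have "card {j \<in> {1..n}. k j \<le> k i} > 0" using i(1) by (auto simp: card_gt_0_iff)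
    ultimately show "y \<in> {1..n}" using i(2) by auto
  qed
  ultimately have "bij_betw \<tau> {1..n} {1..n}"
    by (simp add: bij_betw_def endo_inj_surj)
  then have "\<tau> permutes {1..n}"
    by (rule bij_imp_permutes) (auto simp: \<tau>_def)
  then show "\<exists>\<tau>. \<tau> permutes {1..n} \<and> (\<forall>i\<in>{1..n}. \<forall>j\<in>{1..n}. \<tau> i < \<tau> j \<longleftrightarrow> k i < k j)"
    using iff by blast
next
  fix \<tau> \<tau>'
  assume \<tau>: "\<tau> permutes {1..n} \<and> (\<forall>i\<in>{1..n}. \<forall>j\<in>{1..n}. \<tau> i < \<tau> j \<longleftrightarrow> k i < k j)"
    and \<tau>': "\<tau>' permutes {1..n} \<and> (\<forall>i\<in>{1..n}. \<forall>j\<in>{1..n}. \<tau>' i < \<tau>' j \<longleftrightarrow> k i < k j)"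
  show "\<tau> = \<tau>'"
  proof
    fix i
    show "\<tau> i = \<tau>' i"
    proof (cases "i \<in> {1..n}")
      case True
      have "{j \<in> {1..n}. \<tau> j \<le> \<tau> i} = {j \<in> {1..n}. \<tau>' j \<le> \<tau>' i}"
        using \<tau> \<tau>' True by (metis (no_types, lifting) linorder_not_less Collect_cong)
      then show ?thesis
        using permutes_eq_card[of \<tau> n i] permutes_eq_card[of \<tau>' n i] \<tau> \<tau>' True by simp
    next
      case False
      then show ?thesis using \<tau> \<tau>' by (metis permutes_not_in)
    qed
  qed
qed

section \<open>Rearranging words by permutations\<close>

definition relabel :: "nat \<Rightarrow> (nat \<Rightarrow> nat) \<Rightarrow> nat list \<Rightarrow> nat list" where
  "relabel n \<tau> f = map (\<lambda>i. f ! (\<tau> i - 1)) [1..<Suc n]"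

lemma length_relabel [simp]: "length (relabel n \<tau> f) = n"
  by (simp add: relabel_def)

lemma nth_relabel: "i \<in> {1..n} \<Longrightarrow> relabel n \<tau> f ! (i - 1) = f ! (\<tau> i - 1)"
  by (cases i) (auto simp: relabel_def simp del: upt_Suc)

lemma relabel_relabel:
  assumes "\<tau> permutes {1..n}" "length f = n"
  shows "relabel n \<tau> (relabel n (inv \<tau>) f) = f" "relabel n (inv \<tau>) (relabel n \<tau> f) = f"
proof -
  have *: "relabel n \<sigma> (relabel n (inv \<sigma>) f) = f" if \<sigma>: "\<sigma> permutes {1..n}" for \<sigma>
  proof (rule nth_equalityI)
    fix i assume "i < length (relabel n \<sigma> (relabel n (inv \<sigma>) f))"
    then have i: "Suc i \<in> {1..n}" by auto
    then have "\<sigma> (Suc i) \<in> {1..n}" using permutes_in_image[OF \<sigma>] by blast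
    then show "relabel n \<sigma> (relabel n (inv \<sigma>) f) ! i = f ! i"
      using nth_relabel[OF i, of \<sigma>] nth_relabel[of "\<sigma> (Suc i)" n "inv \<sigma>" f] permutes_inverses(2)[OF \<sigma>]
      by simp
  qed (use assms in simp)
  show "relabel n \<tau> (relabel n (inv \<tau>) f) = f"
    by (rule *[OF assms(1)])
  show "relabel n (inv \<tau>) (relabel n \<tau> f) = f"
    using *[OF permutes_inv[OF assms(1)]] permutes_inv_inv[OF assms(1)] by simp
qed

lemma word_mono_eq_sum: "length f = n \<Longrightarrow> word_mono f = (\<Sum>i\<in>{1..n}. Poly_Mapping.single (f ! (i - 1)) 1)"
  unfolding word_mono_def sum_list_sum_nth
  by (rule sum.reindex_bij_witness[of _ "\<lambda>i. i - 1" Suc]) auto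

lemma word_mono_relabel:
  assumes "\<tau> permutes {1..n}" "length f = n"
  shows "word_mono (relabel n \<tau> f) = word_mono f"
proof -
  have "word_mono (relabel n \<tau> f) = (\<Sum>i\<in>{1..n}. Poly_Mapping.single (f ! (\<tau> i - 1)) 1)"
    by (subst word_mono_eq_sum[of _ n]) (auto simp: nth_relabel simp flip: One_nat_def intro!: sum.cong)
  also have "\<dots> = word_mono f"
    unfolding word_mono_eq_sum[OF assms(2)] 
    using sum.permute[OF assms(1), of "\<lambda>i. Poly_Mapping.single (f ! (i - 1)) 1", symmetric]
    by (simp only: o_def)
  finally show ?thesis .
qed

text \<open>Codes the lexicographic order on pairs (letter, tie-breaker) by one natural number, so
  that \<open>ex1_ranking\<close> can sort such pairs; the base \<open>Suc n\<close> exceeds every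
  tie-breaker.\<close>

lemma lex_code_less_iff:
  fixes a b p q n :: nat
  assumes "p \<le> n" "q \<le> n"
  shows "a * Suc n + p < b * Suc n + q \<longleftrightarrow> a < b \<or> a = b \<and> p < q"
proof -
  have "a * Suc n + p < b * Suc n + q" if "a < b" "p \<le> n" for a b p q
  proof -
    have "Suc a * Suc n \<le> b * Suc n" using that by (intro mult_right_mono) auto
    then show ?thesis using that by simp
  qed
  from this[of a b p q] this[of b a q p] show ?thesis
    using assms by (cases a b rule: linorder_cases) auto
qed

lemma mono_chain_iff:
  fixes K :: "nat \<Rightarrow> nat"
  shows "(\<forall>a\<in>{1..n}. \<forall>b\<in>{1..n}. a < b \<longleftrightarrow> K a < K b) \<longleftrightarrow> (\<forall>i\<in>{1..<n}. K i < K (i + 1))"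
proof
  assume *: "\<forall>i\<in>{1..<n}. K i < K (i + 1)"
  have less: "1 \<le> a \<Longrightarrow> a < b \<Longrightarrow> b \<le> n \<Longrightarrow> K a < K b" for a b
  proof (induction b)
    case (Suc b)
    have "K b < K (Suc b)" using * Suc.prems by auto
    then show ?case using Suc by (cases "a = b") auto
  qed auto
  show "\<forall>a\<in>{1..n}. \<forall>b\<in>{1..n}. a < b \<longleftrightarrow> K a < K b"
  proof (intro ballI)
    fix a b assume "a \<in> {1..n}" "b \<in> {1..n}"
    then show "a < b \<longleftrightarrow> K a < K b"
      using less[of a b] less[of b a] by (cases a b rule: linorder_cases) auto
  qed
next
  assume *: "\<forall>a\<in>{1..n}. \<forall>b\<in>{1..n}. a < b \<longleftrightarrow> K a < K b"
  show "\<forall>i\<in>{1..<n}. K i < K (i + 1)"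
  proof
    fix i assume "i \<in> {1..<n}"
    then show "K i < K (i + 1)" using *[rule_format, of i "i + 1"] by simp
  qed
qed

text \<open>
  The words compatible with \<open>\<pi>\<close> off \<open>S\<close> are sorted by letter, ties being broken by \<open>\<pi>\<close>; the sorting
  permutation \<open>\<tau>\<close> ranges over those with descents in \<open>S\<close>, and the sorted words are those compatible with
  \<open>\<pi> \<circ> inv \<tau>\<close>.
\<close>
lemma word_gf_eq_sum_F:
  assumes \<pi>: "\<pi> permutes {1..n}"
  shows "word_gf n (Des n \<pi>) S = (\<Sum>\<tau> | \<tau> permutes {1..n} \<and> Des n \<tau> \<subseteq> S. F n (Des n (\<pi> \<circ> inv \<tau>)))"
proof
  fix m
  define K where "K = (\<lambda>\<sigma> f i. f ! (i - 1) * Suc n + \<sigma> i :: nat)"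
  define ok where "ok = (\<lambda>\<sigma> i f. f ! (i - 1) \<le> f ! i \<and> (i \<in> Des n \<sigma> \<longrightarrow> f ! (i - 1) < (f ! i :: nat)))"
  define ord where "ord = (\<lambda>\<tau> f. \<forall>i\<in>{1..n}. \<forall>j\<in>{1..n}. \<tau> i < (\<tau> j :: nat) \<longleftrightarrow> K \<pi> f i < K \<pi> f j)"
  define W where "W = {f :: nat list. length f = n \<and> word_mono f = m}"
  define P where "P = {\<tau>. \<tau> permutes {1..n} \<and> Des n \<tau> \<subseteq> S}"
  have finW: "finite {f \<in> W. Q f}" for Q
    by (rule finite_subset[OF _ finite_word_mono[of m "\<lambda>_. True"]]) (auto simp: W_def)
  have K_less: "K \<sigma> f i < K \<sigma> f j \<longleftrightarrow> f ! (i - 1) < f ! (j - 1) \<or> f ! (i - 1) = f ! (j - 1) \<and> \<sigma> i < \<sigma> j"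
    if "\<sigma> permutes {1..n}" "i \<in> {1..n}" "j \<in> {1..n}" for \<sigma> f i j
    unfolding K_def using that permutes_in_image[OF that(1)] by (intro lex_code_less_iff) auto
  have ok_iff: "ok \<sigma> i f \<longleftrightarrow> K \<sigma> f i < K \<sigma> f (i + 1)"
    if "\<sigma> permutes {1..n}" "i \<in> {1..<n}" for \<sigma> f i
  proof -
    \<comment> \<open>Equal neighbouring letters are allowed exactly when \<open>\<sigma>\<close>
      increases there, which is the tie-breaking rule of the key; injectivity excludes equality of
      keys.\<close>
    have "\<sigma> i \<noteq> \<sigma> (i + 1)"
      using permutes_inj[OF that(1)] by (metis add_eq_self_zero injD zero_neq_one)
    then show ?thesis
      using K_less[OF that(1), of i "i + 1" f] that(2) by (auto simp: ok_def Des_def)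
  qed
  have ex1: "\<exists>!\<tau>. \<tau> permutes {1..n} \<and> ord \<tau> f" for f
    unfolding ord_def
  proof (rule ex1_ranking, rule inj_onI)
    fix i j assume ij: "i \<in> {1..n}" "j \<in> {1..n}" "K \<pi> f i = K \<pi> f j"
    then have "\<pi> i = \<pi> j"
      using K_less[OF \<pi> ij(1,2), of f] K_less[OF \<pi> ij(2,1), of f] by (metis less_irrefl linorder_neqE_nat)
    then show "i = j" using permutes_inj[OF \<pi>] by (auto dest: injD)
  qed
  have ok_ord: "(\<forall>i\<in>{1..<n} - S. ok \<pi> i f) \<longleftrightarrow> Des n \<tau> \<subseteq> S"
    if "\<tau> permutes {1..n}" "ord \<tau> f" for \<tau> f
  proof -
    have "ok \<pi> i f \<longleftrightarrow> i \<notin> Des n \<tau>" if i: "i \<in> {1..<n}" for i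
    proof -
      have "\<tau> i \<noteq> \<tau> (i + 1)"
        using permutes_inj[OF \<open>\<tau> permutes _\<close>] by (metis add_eq_self_zero injD zero_neq_one)
      moreover have "\<tau> i < \<tau> (i + 1) \<longleftrightarrow> K \<pi> f i < K \<pi> f (i + 1)"
        using \<open>ord \<tau> f\<close> i by (simp add: ord_def)
      ultimately show ?thesis
        unfolding ok_iff[OF \<pi> i] using i by (auto simp: Des_def)
    qed
    then show ?thesis using Des_subset[of n \<tau>] by blast
  qed
  \<comment> \<open>Reading \<open>f\<close> through \<open>inv \<tau>\<close> sorts it. The
    tie-breaker travels with the letters and becomes \<open>\<pi> \<circ> inv \<tau>\<close>, so the
    sorted words are those whose keys increase at every position.\<close>
  have fiber: "card {f \<in> W. ord \<tau> f} = card {g \<in> W. \<forall>i\<in>{1..<n}. ok (\<pi> \<circ> inv \<tau>) i g}"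
    if \<tau>: "\<tau> permutes {1..n}" for \<tau>
  proof -
    let ?w = "\<pi> \<circ> inv \<tau>"
    have w: "?w permutes {1..n}" using \<pi> \<tau> by (simp add: permutes_compose permutes_inv)
    have inW: "relabel n \<sigma> f \<in> W" if "f \<in> W" "\<sigma> permutes {1..n}" for f \<sigma>
      using that word_mono_relabel[of \<sigma> n f] by (auto simp: W_def)
    have ord_iff: "ord \<tau> f \<longleftrightarrow> (\<forall>i\<in>{1..<n}. ok ?w i (relabel n (inv \<tau>) f))" for f
    proof -
      let ?g = "relabel n (inv \<tau>) f"
      have Kg: "K ?w ?g a = K \<pi> f (inv \<tau> a)" if "a \<in> {1..n}" for a
        using nth_relabel[OF that] by (simp add: K_def)
      have img: "{1..n} = inv \<tau> ` {1..n}"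
        using permutes_image[OF permutes_inv[OF \<tau>]] by simp
      have "ord \<tau> f \<longleftrightarrow> (\<forall>a\<in>{1..n}. \<forall>b\<in>{1..n}. a < b \<longleftrightarrow> K ?w ?g a < K ?w ?g b)"
        unfolding ord_def by (subst (1 2) img) (simp add: permutes_inverses(1)[OF \<tau>] Kg)
      also have "\<dots> \<longleftrightarrow> (\<forall>i\<in>{1..<n}. K ?w ?g i < K ?w ?g (i + 1))"
        by (rule mono_chain_iff)
      also have "\<dots> \<longleftrightarrow> (\<forall>i\<in>{1..<n}. ok ?w i ?g)"
        using ok_iff[OF w] by blast
      finally show ?thesis .
    qed
    have "bij_betw (relabel n (inv \<tau>)) {f \<in> W. ord \<tau> f} {g \<in> W. \<forall>i\<in>{1..<n}. ok ?w i g}"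
    proof (rule bij_betw_byWitness[where f' = "relabel n \<tau>"])
      show "\<forall>f\<in>{f \<in> W. ord \<tau> f}. relabel n \<tau> (relabel n (inv \<tau>) f) = f"
        using relabel_relabel[OF \<tau>] by (auto simp: W_def)
      show "\<forall>g\<in>{g \<in> W. \<forall>i\<in>{1..<n}. ok ?w i g}. relabel n (inv \<tau>) (relabel n \<tau> g) = g"
        using relabel_relabel[OF \<tau>] by (auto simp: W_def)
      show "relabel n (inv \<tau>) ` {f \<in> W. ord \<tau> f} \<subseteq> {g \<in> W. \<forall>i\<in>{1..<n}. ok ?w i g}"
        using ord_iff inW[OF _ permutes_inv[OF \<tau>]] by blast
      show "relabel n \<tau> ` {g \<in> W. \<forall>i\<in>{1..<n}. ok ?w i g} \<subseteq> {f \<in> W. ord \<tau> f}"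
      proof (rule image_subsetI)
        fix g assume "g \<in> {g \<in> W. \<forall>i\<in>{1..<n}. ok ?w i g}"
        then show "relabel n \<tau> g \<in> {f \<in> W. ord \<tau> f}"
          using inW[OF _ \<tau>, of g] ord_iff[of "relabel n \<tau> g"] relabel_relabel(2)[OF \<tau>, of g]
          by (simp add: W_def)
      qed
    qed
    then show ?thesis by (rule bij_betw_same_card)
  qed
  have "{f \<in> W. \<forall>i\<in>{1..<n} - S. ok \<pi> i f} = (\<Union>\<tau>\<in>P. {f \<in> W. ord \<tau> f})"
  proof (intro antisym subsetI)
    fix f assume f: "f \<in> {f \<in> W. \<forall>i\<in>{1..<n} - S. ok \<pi> i f}"
    obtain \<tau> where "\<tau> permutes {1..n}" "ord \<tau> f" using ex1[of f] by blast
    then show "f \<in> (\<Union>\<tau>\<in>P. {f \<in> W. ord \<tau> f})"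
      using f ok_ord[of \<tau> f] by (auto simp: P_def)
  next
    fix f assume "f \<in> (\<Union>\<tau>\<in>P. {f \<in> W. ord \<tau> f})"
    then show "f \<in> {f \<in> W. \<forall>i\<in>{1..<n} - S. ok \<pi> i f}"
      using ok_ord[of _ f] unfolding P_def by blast
  qed
  moreover have "card (\<Union>\<tau>\<in>P. {f \<in> W. ord \<tau> f}) = (\<Sum>\<tau>\<in>P. card {f \<in> W. ord \<tau> f})"
  proof (rule card_UN_disjoint)
    show "finite P"
      by (rule finite_subset[OF _ finite_permutations[of "{1..n}"]]) (auto simp: P_def)
    show "\<forall>\<tau>\<in>P. \<forall>\<sigma>\<in>P. \<tau> \<noteq> \<sigma> \<longrightarrow> {f \<in> W. ord \<tau> f} \<inter> {f \<in> W. ord \<sigma> f} = {}"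
      using ex1 unfolding P_def by blast
  qed (use finW in blast)
  moreover have "\<dots> = (\<Sum>\<tau>\<in>P. card {g \<in> W. \<forall>i\<in>{1..<n}. ok (\<pi> \<circ> inv \<tau>) i g})"
    using fiber by (intro sum.cong) (auto simp: P_def)
  ultimately have *: "card {f \<in> W. \<forall>i\<in>{1..<n} - S. ok \<pi> i f}
      = (\<Sum>\<tau>\<in>P. card {g \<in> W. \<forall>i\<in>{1..<n}. ok (\<pi> \<circ> inv \<tau>) i g})"
    by simp
  have word_gf: "word_gf n (Des n \<sigma>) T m = of_nat (card {f \<in> W. \<forall>i\<in>{1..<n} - T. ok \<sigma> i f})" for \<sigma> T
    by (simp add: word_gf_def W_def ok_def conj_assoc)
  show "word_gf n (Des n \<pi>) S m
      = (\<Sum>\<tau> | \<tau> permutes {1..n} \<and> Des n \<tau> \<subseteq> S. F n (Des n (\<pi> \<circ> inv \<tau>))) m"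
    unfolding sum_fun_apply word_gf * P_def[symmetric] by simp
qed

text \<open>Every admissible set is the descent set of some permutation, so the sorting formula
  covers arbitrary \<open>D\<close>.\<close>

lemma word_gf_Qdeg: "word_gf n D S \<in> Qdeg n"
proof -
  obtain \<pi> where "\<pi> permutes {1..n}" "Des n \<pi> = D \<inter> {1..<n}"
    using ex_permutes_Des[of "D \<inter> {1..<n}"] by auto
  moreover have "word_gf n D S = word_gf n (D \<inter> {1..<n}) S" by (rule word_gf_cong) auto
  ultimately have "word_gf n D S = (\<Sum>\<tau> | \<tau> permutes {1..n} \<and> Des n \<tau> \<subseteq> S. F n (Des n (\<pi> \<circ> inv \<tau>)))"
    using word_gf_eq_sum_F[of \<pi> n S] by simp
  then show ?thesis
    using F_Qdeg unfolding Qdeg_def by (simp add: fvs.span_sum)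
qed


section \<open>Hopf endomorphisms\<close>

lemma coord_QM: "f \<in> QSym \<Longrightarrow> \<alpha> \<in> Comps \<Longrightarrow> coord QM Comps f \<alpha> = f (mon \<alpha>)"
  unfolding QSym_def by (rule coord_dual_point) (simp_all add: QM_mon)

lemma QM_inj: "inj_on QM Comps"
  by (rule dual_points_inj[where p = mon]) (simp add: QM_mon)

lemma tensor_dual:
  assumes "p \<in> Comps \<times> Comps" "q \<in> Comps \<times> Comps"
  shows "(case p of (\<alpha>, \<beta>) \<Rightarrow> tensor (QM \<alpha>) (QM \<beta>)) (case q of (\<alpha>, \<beta>) \<Rightarrow> (mon \<alpha>, mon \<beta>))
    = (if p = q then 1 else 0)"
  using assms by (cases p; cases q) (auto simp: tensor_def QM_mon)

lemma tensor_inj: "inj_on (\<lambda>(\<alpha>, \<beta>). tensor (QM \<alpha>) (QM \<beta>)) (Comps \<times> Comps)"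
  by (rule dual_points_inj[where p = "\<lambda>(\<alpha>, \<beta>). (mon \<alpha>, mon \<beta>)"]) (rule tensor_dual)

text \<open>Deconcatenation is dual to concatenation: the tensor indexed by \<open>\<alpha>'\<close>
  and \<open>\<alpha>''\<close> arises only from \<open>\<alpha>' @ \<alpha>''\<close>, and from
  just one cut of it.\<close>

lemma qcoprod_mon:
  assumes f: "f \<in> Qdeg n" and \<alpha>: "\<alpha>' \<in> Comps" "\<alpha>'' \<in> Comps"
  shows "qcoprod f (mon \<alpha>', mon \<alpha>'') = f (mon (\<alpha>' @ \<alpha>''))"
proof -
  let ?X = "{\<alpha> \<in> Comps. coord QM Comps f \<alpha> \<noteq> 0}"
  have QS: "f \<in> QSym" using f Qdeg_QSym by blast
  have inner: "(\<Sum>i\<le>length \<alpha>. tensor (QM (take i \<alpha>)) (QM (drop i \<alpha>))) (mon \<alpha>', mon \<alpha>'')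
      = (if \<alpha> = \<alpha>' @ \<alpha>'' then 1 else 0)" if "\<alpha> \<in> Comps" for \<alpha>
  proof -
    have td: "take i \<alpha> \<in> Comps" "drop i \<alpha> \<in> Comps" for i
      using append_Comps_iff[of "take i \<alpha>" "drop i \<alpha>"] that by auto
    have "(\<Sum>i\<le>length \<alpha>. tensor (QM (take i \<alpha>)) (QM (drop i \<alpha>))) (mon \<alpha>', mon \<alpha>'')
        = (\<Sum>i\<le>length \<alpha>. if i = length \<alpha>' then (if \<alpha> = \<alpha>' @ \<alpha>'' then 1 else 0) else 0)"
      unfolding sum_fun_apply
    proof (rule sum.cong[OF refl])
      fix i assume "i \<in> {..length \<alpha>}"
      \<comment> \<open>The length of the left piece fixes the place of the cut.\<close>
      then have iff: "take i \<alpha> = \<alpha>' \<and> drop i \<alpha> = \<alpha>'' \<longleftrightarrow> i = length \<alpha>' \<and> \<alpha> = \<alpha>' @ \<alpha>''"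
        by (metis append_eq_conv_conj append_take_drop_id atMost_iff length_take min.absorb2)
      have "tensor (QM (take i \<alpha>)) (QM (drop i \<alpha>)) (mon \<alpha>', mon \<alpha>'')
          = (if take i \<alpha> = \<alpha>' \<and> drop i \<alpha> = \<alpha>'' then 1 else 0)"
        by (simp add: tensor_def QM_mon td \<alpha> split: if_split)
      then show "tensor (QM (take i \<alpha>)) (QM (drop i \<alpha>)) (mon \<alpha>', mon \<alpha>'')
          = (if i = length \<alpha>' then (if \<alpha> = \<alpha>' @ \<alpha>'' then 1 else 0) else 0)"
        unfolding iff by simp
    qed
    also have "\<dots> = (if \<alpha> = \<alpha>' @ \<alpha>'' then 1 else 0)" by auto
    finally show ?thesis .
  qed
  have "qcoprod f (mon \<alpha>', mon \<alpha>'') = (\<Sum>\<alpha>\<in>?X. coord QM Comps f \<alpha> *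
      (\<Sum>i\<le>length \<alpha>. tensor (QM (take i \<alpha>)) (QM (drop i \<alpha>))) (mon \<alpha>', mon \<alpha>''))"
    unfolding qcoprod_def by (subst sum_fun_apply) (simp add: fscale_apply)
  also have "\<dots> = (\<Sum>\<alpha>\<in>?X. if \<alpha> = \<alpha>' @ \<alpha>'' then f (mon (\<alpha>' @ \<alpha>'')) else 0)"
    using inner by (intro sum.cong) (auto simp: coord_QM[OF QS])
  also have "\<dots> = (if \<alpha>' @ \<alpha>'' \<in> ?X then f (mon (\<alpha>' @ \<alpha>'')) else 0)"
    using finite_coord_support[OF QM_inj] by simp
  also have "\<dots> = f (mon (\<alpha>' @ \<alpha>''))"
    using \<alpha> coord_QM[OF QS, of "\<alpha>' @ \<alpha>''"] by (auto simp: append_Comps_iff)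
  finally show ?thesis .
qed

lemma qcoprod_span: "qcoprod f \<in> fvs.span ((\<lambda>(\<alpha>, \<beta>). tensor (QM \<alpha>) (QM \<beta>)) ` (Comps \<times> Comps))"
  unfolding qcoprod_def
proof (intro fvs.span_sum fvs.span_scale fvs.span_base)
  fix \<alpha> i assume "\<alpha> \<in> {\<alpha> \<in> Comps. coord QM Comps f \<alpha> \<noteq> 0}"
  then have "take i \<alpha> \<in> Comps" "drop i \<alpha> \<in> Comps"
    using append_Comps_iff[of "take i \<alpha>" "drop i \<alpha>"] by auto
  then show "tensor (QM (take i \<alpha>)) (QM (drop i \<alpha>)) \<in> (\<lambda>(\<alpha>, \<beta>). tensor (QM \<alpha>) (QM \<beta>)) ` (Comps \<times> Comps)"
    by (intro image_eqI[of _ _ "(take i \<alpha>, drop i \<alpha>)"]) auto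
qed

lemma tensor_coord_qcoprod:
  assumes "f \<in> Qdeg n" "\<alpha>' \<in> Comps" "\<alpha>'' \<in> Comps"
  shows "tensor_coord (qcoprod f) (\<alpha>', \<alpha>'') = f (mon (\<alpha>' @ \<alpha>''))"
  unfolding tensor_coord_def
  using coord_dual_point[OF tensor_dual qcoprod_span, of "(\<alpha>', \<alpha>'')" f] qcoprod_mon[OF assms] assms
  by simp

text \<open>The seam \<open>i\<close> is itself a partial sum of \<open>\<alpha> @ \<beta>\<close>,
  so a descent there costs nothing; the other positions fall below or above it, and the two
  conditions are independent.\<close>

lemma F_mon_append:
  assumes "\<alpha> \<in> Comp i" "\<beta> \<in> Comp j" "0 < i" "0 < j"
  shows "F (i + j) D (mon (\<alpha> @ \<beta>)) = F i D (mon \<alpha>) * F j {d. d + i \<in> D} (mon \<beta>)"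
proof -
  have ne: "\<alpha> \<noteq> []" "\<beta> \<noteq> []" using assms by auto
  have ps: "part_sums (\<alpha> @ \<beta>) = part_sums \<alpha> \<union> insert i ((+) i ` part_sums \<beta>)"
    using part_sums_append[OF ne] assms by (simp add: sum_list_Comp)
  have "D \<inter> {1..<i + j} \<subseteq> part_sums (\<alpha> @ \<beta>)
      \<longleftrightarrow> D \<inter> {1..<i} \<subseteq> part_sums \<alpha> \<and> {d. d + i \<in> D} \<inter> {1..<j} \<subseteq> part_sums \<beta>"
    (is "?L \<longleftrightarrow> ?R1 \<and> ?R2")
  proof (intro iffI conjI subsetI)
    fix x assume L: ?L and x: "x \<in> D \<inter> {1..<i}"
    then have "x \<in> part_sums (\<alpha> @ \<beta>)" by auto
    then show "x \<in> part_sums \<alpha>" using x by (auto simp: ps)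
  next
    fix x assume L: ?L and x: "x \<in> {d. d + i \<in> D} \<inter> {1..<j}"
    then have "x + i \<in> part_sums (\<alpha> @ \<beta>)" by auto
    then show "x \<in> part_sums \<beta>" using x part_sums_subset[OF assms(1)] by (auto simp: ps)
  next
    fix x assume R: "?R1 \<and> ?R2" and x: "x \<in> D \<inter> {1..<i + j}"
    consider "x < i" | "x = i" | k where "x = i + k" "0 < k"
      by (metis less_imp_add_positive nat_neq_iff)
    then show "x \<in> part_sums (\<alpha> @ \<beta>)"
    proof cases
      case 3
      then have "k \<in> part_sums \<beta>" using R x by (auto simp: add.commute)
      then show ?thesis using 3 by (auto simp: ps)
    qed (use R x in \<open>auto simp: ps\<close>)
  qed
  then show ?thesis
    using F_packed_mono[OF part_sums_subset[OF assms(1)]] F_packed_mono[OF part_sums_subset[OF assms(2)]]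
      F_packed_mono[OF part_sums_subset[OF Comp_append[OF assms(1,2)]]] assms
    by (simp add: sum_list_Comp)
qed

locale qsym_endomorphism =
  fixes \<Phi> :: "pser \<Rightarrow> pser"
  assumes hopf_End: "\<Phi> \<in> hopf_End"
begin

lemma Phi_add: "f \<in> QSym \<Longrightarrow> g \<in> QSym \<Longrightarrow> \<Phi> (f + g) = \<Phi> f + \<Phi> g"
  and Phi_scale: "f \<in> QSym \<Longrightarrow> \<Phi> (fscale c f) = fscale c (\<Phi> f)"
  and Phi_mult: "f \<in> QSym \<Longrightarrow> g \<in> QSym \<Longrightarrow> \<Phi> (ps_mult f g) = ps_mult (\<Phi> f) (\<Phi> g)"
  and Phi_coprod: "f \<in> QSym \<Longrightarrow> qcoprod (\<Phi> f) = tensor_map \<Phi> \<Phi> (qcoprod f)"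
  using hopf_End unfolding hopf_End_def by blast+

lemma Phi_Qdeg: "f \<in> Qdeg n \<Longrightarrow> \<Phi> f \<in> Qdeg n"
  using hopf_End unfolding hopf_End_def by blast

lemma QSym_0: "0 \<in> QSym"
  unfolding QSym_def by (rule fvs.span_zero)

lemma Phi_0: "\<Phi> 0 = 0"
  using Phi_scale[OF QSym_0, of 0] by (simp add: fvs.scale_zero_left)

lemma Phi_sum:
  assumes "\<And>i. i \<in> I \<Longrightarrow> f i \<in> QSym"
  shows "\<Phi> (\<Sum>i\<in>I. f i) = (\<Sum>i\<in>I. \<Phi> (f i))"
  using assms
proof (induction I rule: infinite_finite_induct)
  case (insert i I)
  then have "(\<Sum>i\<in>I. f i) \<in> QSym"
    unfolding QSym_def by (intro fvs.span_sum) auto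
  then have "\<Phi> (f i + (\<Sum>i\<in>I. f i)) = \<Phi> (f i) + (\<Sum>i\<in>I. \<Phi> (f i))"
    using insert by (subst Phi_add) auto
  then show ?case by (simp only: sum.insert[OF insert(1,2)])
qed (simp_all add: Phi_0)

lemma Phi_F_eq_sum: "\<Phi> (F n D) m = (\<Sum>\<alpha>\<in>Comp n. F n D (mon \<alpha>) * \<Phi> (QM \<alpha>) m)"
proof -
  have "\<Phi> (F n D) = \<Phi> (\<Sum>\<alpha>\<in>Comp n. fscale (F n D (mon \<alpha>)) (QM \<alpha>))"
    using Qdeg_expand[OF F_Qdeg, of n D] by simp
  also have "\<dots> = (\<Sum>\<alpha>\<in>Comp n. \<Phi> (fscale (F n D (mon \<alpha>)) (QM \<alpha>)))"
    using QM_Qdeg[of _ n] Qdeg_QSym[of n] by (intro Phi_sum) (auto simp: QSym_def intro!: fvs.span_scale)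
  also have "\<dots> = (\<Sum>\<alpha>\<in>Comp n. fscale (F n D (mon \<alpha>)) (\<Phi> (QM \<alpha>)))"
    using QM_Qdeg[of _ n] Qdeg_QSym[of n] by (intro sum.cong refl Phi_scale) auto
  finally show ?thesis by (simp add: sum_fun_apply fscale_apply)
qed

text \<open>Comultiplicativity in coordinates: the left side is a tensor coefficient of
  \<open>qcoprod (\<Phi> (F (i + j) D))\<close>, and it is computed by applying
  \<open>\<Phi>\<close> to both legs of the coproduct of \<open>F (i + j) D\<close>. The
  factorization of \<open>F\<close> at the seam then separates the double sum.\<close>

lemma Phi_F_mon_append:
  assumes "\<beta>' \<in> Comp i" "\<beta>'' \<in> Comp j" "0 < i" "0 < j"
  shows "\<Phi> (F (i + j) D) (mon (\<beta>' @ \<beta>'')) = \<Phi> (F i D) (mon \<beta>') * \<Phi> (F j {d. d + i \<in> D}) (mon \<beta>'')"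
proof -
  let ?f = "F (i + j) D"
  let ?t = "\<lambda>(\<alpha>', \<alpha>''). ?f (mon (\<alpha>' @ \<alpha>'')) * (\<Phi> (QM \<alpha>') (mon \<beta>') * \<Phi> (QM \<alpha>'') (mon \<beta>''))"
  let ?X = "{p \<in> Comps \<times> Comps. tensor_coord (qcoprod ?f) p \<noteq> 0}"
  have f: "?f \<in> Qdeg (i + j)" by (rule F_Qdeg)
  have tc: "tensor_coord (qcoprod ?f) (\<alpha>', \<alpha>'') = ?f (mon (\<alpha>' @ \<alpha>''))"
    if "\<alpha>' \<in> Comps" "\<alpha>'' \<in> Comps" for \<alpha>' \<alpha>''
    by (rule tensor_coord_qcoprod[OF f that])
  \<comment> \<open>The coproduct has components in all bidegrees of total degree
    \<open>i + j\<close>; preservation of degree by \<open>\<Phi>\<close> leaves only the bidegree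
    \<open>(i, j)\<close>.\<close>
  have zero: "\<Phi> (QM \<alpha>) (mon \<beta>) = 0" if "\<beta> \<in> Comp k" "\<alpha> \<in> Comps" "\<alpha> \<notin> Comp k" for \<alpha> \<beta> k
  proof (rule Qdeg_eval_other_degree[OF Phi_Qdeg[OF QM_Qdeg]])
    show "\<alpha> \<in> Comp (sum_list \<alpha>)" using that by (simp add: in_Comps_iff)
    then show "sum_list \<beta> \<noteq> sum_list \<alpha>" using that sum_list_Comp[of \<beta> k] by metis
  qed
  have finX: "finite ?X"
    unfolding tensor_coord_def by (rule finite_coord_support[OF tensor_inj])
  have "\<Phi> ?f (mon (\<beta>' @ \<beta>'')) = qcoprod (\<Phi> ?f) (mon \<beta>', mon \<beta>'')"
    using qcoprod_mon[OF Phi_Qdeg[OF f]] assms Comp_Comps by metis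
  also have "\<dots> = (\<Sum>p\<in>?X. ?t p)"
  proof -
    have "qcoprod (\<Phi> ?f) = tensor_map \<Phi> \<Phi> (qcoprod ?f)"
      using f Qdeg_QSym by (intro Phi_coprod) auto
    then have "qcoprod (\<Phi> ?f) (mon \<beta>', mon \<beta>'')
        = (\<Sum>(\<alpha>', \<alpha>'')\<in>?X. tensor_coord (qcoprod ?f) (\<alpha>', \<alpha>'') *
            (\<Phi> (QM \<alpha>') (mon \<beta>') * \<Phi> (QM \<alpha>'') (mon \<beta>'')))"
      by (simp add: tensor_map_def sum_fun_apply split_beta fscale_apply tensor_def)
    also have "\<dots> = (\<Sum>p\<in>?X. ?t p)"
      using tc by (intro sum.cong) auto
    finally show ?thesis .
  qed
  also have "\<dots> = (\<Sum>p\<in>?X \<inter> (Comp i \<times> Comp j). ?t p)"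
  proof (rule sum.mono_neutral_right[OF finX])
    show "\<forall>p\<in>?X - ?X \<inter> (Comp i \<times> Comp j). ?t p = 0"
    proof
      fix p assume p: "p \<in> ?X - ?X \<inter> (Comp i \<times> Comp j)"
      obtain a b where ab: "p = (a, b)" by (cases p)
      have "a \<in> Comps" "b \<in> Comps" "a \<notin> Comp i \<or> b \<notin> Comp j" using p ab by auto
      then show "?t p = 0" using zero[OF assms(1), of a] zero[OF assms(2), of b] ab by fastforce
    qed
  qed auto
  also have "\<dots> = (\<Sum>p\<in>Comp i \<times> Comp j. ?t p)"
  proof (rule sum.mono_neutral_left)
    show "\<forall>p\<in>Comp i \<times> Comp j - ?X \<inter> (Comp i \<times> Comp j). ?t p = 0"
      using tc Comp_Comps by fastforce
  qed auto
  also have "\<dots> = (\<Sum>(\<alpha>', \<alpha>'')\<in>Comp i \<times> Comp j. (F i D (mon \<alpha>') * \<Phi> (QM \<alpha>') (mon \<beta>'))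
      * (F j {d. d + i \<in> D} (mon \<alpha>'') * \<Phi> (QM \<alpha>'') (mon \<beta>'')))"
    using F_mon_append[of _ i _ j D] assms by (intro sum.cong) auto
  also have "\<dots> = \<Phi> (F i D) (mon \<beta>') * \<Phi> (F j {d. d + i \<in> D}) (mon \<beta>'')"
    unfolding Phi_F_eq_sum sum_product sum.cartesian_product ..
  finally show ?thesis .
qed

lemma mult_chi:
  assumes "f \<in> Qdeg i" "g \<in> Qdeg j"
  shows "\<Phi> (ps_mult f g) (packed_mono (i + j) {}) = \<Phi> f (packed_mono i {}) * \<Phi> g (packed_mono j {})"
proof -
  have "f \<in> QSym" "g \<in> QSym" using assms Qdeg_QSym by auto
  then show ?thesis
    using ps_mult_single_Qdeg[OF Phi_Qdeg[OF assms(1)] Phi_Qdeg[OF assms(2)]] by (simp add: Phi_mult)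
qed

text \<open>Comultiplicativity turns the coefficient into a product of characters over the blocks of
  \<open>\<beta>\<close>; multiplicativity of \<open>\<Phi>\<close> fuses these into the character
  of one product of fundamental functions, in which the block ends are the free seams. All
  coefficients are thereby reduced to a single linear functional.\<close>

lemma Phi_F_mon_eq_word_gf: "\<beta> \<in> Comp n \<Longrightarrow> \<Phi> (F n D) (mon \<beta>) = \<Phi> (word_gf n D (part_sums \<beta>)) (packed_mono n {})"
proof (induction \<beta> arbitrary: n D)
  case Nil
  then show ?case by simp
next
  case (Cons b \<beta>)
  show ?case
  proof (cases "\<beta> = []")
    case True
    then show ?thesis using Cons.prems by (cases "b = n") auto
  next
    case False
    define j where "j = n - b"
    have n: "n = b + j" "0 < b" "\<beta> \<in> Comp j" using Cons.prems by (auto simp: j_def)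
    then have "0 < j" using False by (cases "j = 0") auto
    have b: "[b] \<in> Comp b" using n by simp
    have "\<Phi> (F n D) (mon (b # \<beta>)) = \<Phi> (F b D) (packed_mono b {}) * \<Phi> (F j {d. d + b \<in> D}) (mon \<beta>)"
      using Phi_F_mon_append[OF b n(3) n(2) \<open>0 < j\<close>, of D] by (simp add: n(1))
    also have "\<dots> = \<Phi> (F b D) (packed_mono b {}) * \<Phi> (word_gf j {d. d + b \<in> D} (part_sums \<beta>)) (packed_mono j {})"
      using Cons.IH[OF n(3)] by simp
    also have "\<dots> = \<Phi> (word_gf n D (part_sums (b # \<beta>))) (packed_mono n {})"
      using mult_chi[OF word_gf_Qdeg word_gf_Qdeg, of b D "{}" j "{d. d + b \<in> D}" "part_sums \<beta>"]
        ps_mult_word_gf[OF n(2) \<open>0 < j\<close>] False by (simp add: part_sums_Cons n(1))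
    finally show ?thesis .
  qed
qed

text \<open>Degree 1 is a line spanned by \<open>QM [1]\<close>, so the description defining
  \<open>lam\<close> has exactly one solution.\<close>

lemma Phi_QM_1: "\<Phi> (QM [1]) = fscale (lam \<Phi>) (QM [1])"
proof -
  have C1: "Comp 1 = {[1]}"
  proof -
    have "\<alpha> \<in> Comp 1 \<longleftrightarrow> \<alpha> = [1]" for \<alpha> by (cases \<alpha>) auto
    then show ?thesis by auto
  qed
  have one: "QM [1] (mon [1]) = 1"
    using QM_mon[of "[1]" "[1]"] by (simp add: in_Comps_iff)
  have ex: "\<Phi> (QM [1]) = fscale (\<Phi> (QM [1]) (mon [1])) (QM [1])"
    using Qdeg_expand[OF Phi_Qdeg[OF QM_Qdeg], of "[1]" 1] C1 by simp
  have "lam \<Phi> = \<Phi> (QM [1]) (mon [1])"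
    unfolding lam_def
  proof (rule the_equality, rule ex)
    fix l assume "\<Phi> (QM [1]) = fscale l (QM [1])"
    then show "l = \<Phi> (QM [1]) (mon [1])" by (metis fscale_apply one mult_1_right)
  qed
  then show ?thesis using ex by simp
qed

text \<open>The composition \<open>one_col n\<close> has \<open>n\<close> blocks of size 1, each
  contributing a factor \<open>lam \<Phi>\<close>, whatever \<open>D\<close> is.\<close>

lemma Phi_F_one_col: "\<Phi> (F n D) (packed_mono n {1..<n}) = lam \<Phi> ^ n"
proof (induction n arbitrary: D)
  case 0
  have "F 0 D = QM []"
    unfolding F_eq_sum_QM by simp
  also have "QM [] = ps_one"
    using QM_eq_card[of "[]" 0] by (auto simp: ps_one_def fun_eq_iff cong: conj_cong)
  finally have "\<Phi> (F 0 D) = ps_one"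
    using hopf_End by (simp add: hopf_End_def)
  then show ?case by (simp add: ps_one_def packed_mono_def)
next
  case (Suc n)
  have one: "\<Phi> (F 1 D) (mon [1]) = lam \<Phi>"
  proof -
    have "F 1 D = QM [1]"
    proof -
      have "{\<beta> \<in> Comp 1. D \<inter> {1..<1} \<subseteq> part_sums \<beta>} = {[1]}"
      proof -
        have "\<alpha> \<in> Comp 1 \<longleftrightarrow> \<alpha> = [1]" for \<alpha> by (cases \<alpha>) auto
        then show ?thesis by auto
      qed
      then show ?thesis unfolding F_eq_sum_QM by simp
    qed
    then show ?thesis
      using Phi_QM_1 QM_mon[of "[1]" "[1]"] by (simp add: in_Comps_iff fscale_apply)
  qed
  show ?case
  proof (cases "n = 0")
    case True
    then show ?thesis using one by simp
  next
    case False
    have "\<Phi> (F (1 + n) D) (mon ([1] @ one_col n)) = \<Phi> (F 1 D) (mon [1]) * \<Phi> (F n {d. d + 1 \<in> D}) (mon (one_col n))"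
      using False by (intro Phi_F_mon_append one_col_Comp) simp_all
    moreover have "[1] @ one_col n = one_col (Suc n)" by (simp add: one_col_def)
    ultimately show ?thesis
      using one Suc.IH sum_list_Comp[OF one_col_Comp] part_sums_one_col by simp
  qed
qed

text \<open>
  The value at \<open>packed_mono n {}\<close>, i.e. at \<open>x\<^sub>0 = 1\<close> and all other variables \<open>0\<close>, is the
  universal character of \<open>QSym\<close>.
\<close>
definition chi :: "nat \<Rightarrow> (nat \<Rightarrow> nat) \<Rightarrow> rat" where
  "chi n \<sigma> = \<Phi> (F n (Des n \<sigma>)) (packed_mono n {})"

lemma chi_cong: "Des n \<sigma> = Des n \<tau> \<Longrightarrow> chi n \<sigma> = chi n \<tau>"
  by (simp add: chi_def)

lemma Phi_F_packed_mono:
  assumes "\<pi> permutes {1..n}" "S \<subseteq> {1..<n}"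
  shows "\<Phi> (F n (Des n \<pi>)) (packed_mono n S) = (\<Sum>\<tau> | \<tau> permutes {1..n} \<and> Des n \<tau> \<subseteq> S. chi n (\<pi> \<circ> inv \<tau>))"
proof -
  obtain \<beta> where \<beta>: "\<beta> \<in> Comp n" "part_sums \<beta> = S"
    using part_sums_surj[OF assms(2)] by blast
  have "\<Phi> (F n (Des n \<pi>)) (packed_mono n S) = \<Phi> (word_gf n (Des n \<pi>) S) (packed_mono n {})"
    using Phi_F_mon_eq_word_gf[OF \<beta>(1)] \<beta> by (simp add: sum_list_Comp)
  also have "\<dots> = (\<Sum>\<tau> | \<tau> permutes {1..n} \<and> Des n \<tau> \<subseteq> S. chi n (\<pi> \<circ> inv \<tau>))"
    unfolding word_gf_eq_sum_F[OF assms(1)] chi_def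
    using F_Qdeg Qdeg_QSym by (subst Phi_sum) (auto simp: sum_fun_apply)
  finally show ?thesis .
qed

text \<open>The restriction \<open>Des n \<tau> \<subseteq> S\<close> in
  \<open>Phi_F_packed_mono\<close> is the value of \<open>F n (Des n \<tau>)\<close> at the packed
  monomial of \<open>S\<close>, so the two sides agree at all these points.\<close>

lemma Phi_F_expansion:
  assumes "\<pi> permutes {1..n}"
  shows "\<Phi> (F n (Des n \<pi>)) = (\<Sum>\<tau> | \<tau> permutes {1..n}. fscale (chi n (\<pi> \<circ> inv \<tau>)) (F n (Des n \<tau>)))"
proof (rule Qdeg_eqI[of _ n])
  show "\<Phi> (F n (Des n \<pi>)) \<in> Qdeg n" by (intro Phi_Qdeg F_Qdeg)
  show "(\<Sum>\<tau> | \<tau> permutes {1..n}. fscale (chi n (\<pi> \<circ> inv \<tau>)) (F n (Des n \<tau>))) \<in> Qdeg n"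
    using F_Qdeg unfolding Qdeg_def by (intro fvs.span_sum fvs.span_scale) auto
  fix S assume S: "S \<subseteq> {1..<n}"
  have "(\<Sum>\<tau> | \<tau> permutes {1..n}. fscale (chi n (\<pi> \<circ> inv \<tau>)) (F n (Des n \<tau>))) (packed_mono n S)
      = (\<Sum>\<tau> | \<tau> permutes {1..n}. if Des n \<tau> \<subseteq> S then chi n (\<pi> \<circ> inv \<tau>) else 0)"
    unfolding sum_fun_apply fscale_apply F_packed_mono[OF S] using Des_subset[of n]
    by (intro sum.cong) (auto simp: Int_absorb2)
  also have "\<dots> = \<Phi> (F n (Des n \<pi>)) (packed_mono n S)"
    unfolding Phi_F_packed_mono[OF assms S]
    by (subst sum.inter_filter[symmetric]) (auto simp: finite_permutations)
  finally show "\<Phi> (F n (Des n \<pi>)) (packed_mono n S)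
      = (\<Sum>\<tau> | \<tau> permutes {1..n}. fscale (chi n (\<pi> \<circ> inv \<tau>)) (F n (Des n \<tau>))) (packed_mono n S)" ..
qed

text \<open>For the full set \<open>{1..<n}\<close> the descent restriction disappears, and with
  \<open>\<pi> = id\<close> the sum runs over all inverses.\<close>

lemma sum_chi: "(\<Sum>\<sigma> | \<sigma> permutes {1..n}. chi n \<sigma>) = lam \<Phi> ^ n"
proof -
  have "lam \<Phi> ^ n = \<Phi> (F n (Des n id)) (packed_mono n {1..<n})"
    by (simp only: Phi_F_one_col)
  also have "\<dots> = (\<Sum>\<tau> | \<tau> permutes {1..n}. chi n (inv \<tau>))"
    using Des_subset[of n] by (subst Phi_F_packed_mono) (auto simp: permutes_id)
  also have "\<dots> = (\<Sum>\<sigma> | \<sigma> permutes {1..n}. chi n \<sigma>)"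
    by (rule sum.reindex_bij_witness[of _ inv inv]) (auto simp: permutes_inv permutes_inv_inv)
  finally show ?thesis ..
qed

end

section \<open>Coordinates in the fundamental basis\<close>

lemma QF_part_sums_packed_mono:
  "\<alpha> \<in> Comp n \<Longrightarrow> S \<subseteq> {1..<n} \<Longrightarrow> QF \<alpha> (packed_mono n S) = (if part_sums \<alpha> \<subseteq> S then 1 else 0)"
  using F_packed_mono[of S n "part_sums \<alpha>"] part_sums_subset[of \<alpha> n] by (simp add: QF_eq_F Int_absorb2)

lemma QF_Comps_packed_mono:
  assumes "\<alpha> \<in> Comps" "S \<subseteq> {1..<n}"
  shows "QF \<alpha> (packed_mono n S) = (if \<alpha> \<in> Comp n \<and> part_sums \<alpha> \<subseteq> S then 1 else 0)"
proof (cases "\<alpha> \<in> Comp n")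
  case False
  then have "n \<noteq> sum_list \<alpha>" "QF \<alpha> \<in> Qdeg (sum_list \<alpha>)"
    using assms F_Qdeg by (auto simp: in_Comps_iff QF_eq_F)
  then show ?thesis using Qdeg_eval_other_degree False by auto
qed (use assms QF_part_sums_packed_mono in simp)

text \<open>Packed monomials give a unitriangular system for the fundamental functions. Coefficients
  are shown to vanish in order of the number of partial sums, since evaluation at
  \<open>\<beta>\<close> sees only compositions coarser than or equal to
  \<open>\<beta>\<close>.\<close>

lemma QF_independent:
  shows QF_inj: "inj_on QF Comps" and "fvs.independent (QF ` Comps)"
proof -
  show inj: "inj_on QF Comps"
  proof (rule inj_onI)
    fix \<alpha> \<beta> assume *: "\<alpha> \<in> Comps" "\<beta> \<in> Comps" "QF \<alpha> = QF \<beta>"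
    have "\<beta> \<in> Comp (sum_list \<alpha>) \<and> part_sums \<beta> \<subseteq> part_sums \<alpha>" if "\<alpha> \<in> Comps" "\<beta> \<in> Comps" "QF \<alpha> = QF \<beta>" for \<alpha> \<beta>
    proof -
      have \<alpha>: "\<alpha> \<in> Comp (sum_list \<alpha>)" using that by (simp add: in_Comps_iff)
      then show ?thesis
        using QF_Comps_packed_mono[OF that(1) part_sums_subset[OF \<alpha>]]
          QF_Comps_packed_mono[OF that(2) part_sums_subset[OF \<alpha>]] that(3) by (auto split: if_splits)
    qed
    from this[OF *] this[OF *(2,1) *(3)[symmetric]]
    show "\<alpha> = \<beta>" using part_sums_inj by (metis in_Comps_iff *(1) subset_antisym)
  qed
  show "fvs.independent (QF ` Comps)"
  proof (rule fvs.independent_explicit_module[THEN iffD2], intro allI impI)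
    fix T u v
    assume T: "finite T" "T \<subseteq> QF ` Comps" and 0: "(\<Sum>v\<in>T. fscale (u v) v) = 0" and v: "v \<in> T"
    obtain J where J: "J \<subseteq> Comps" "T = QF ` J"
      using T(2) by (auto simp: subset_image_iff)
    have injJ: "inj_on QF J" using inj J(1) by (rule inj_on_subset)
    then have finJ: "finite J" using T(1) J(2) by (simp add: finite_image_iff)
    have "u (QF \<beta>) = 0" if "\<beta> \<in> J" for \<beta>
      using that
    proof (induction "card (part_sums \<beta>)" arbitrary: \<beta> rule: less_induct)
      case less
      define n where "n = sum_list \<beta>"
      have \<beta>: "\<beta> \<in> Comp n" using less.prems J by (auto simp: in_Comps_iff n_def)
      have S: "part_sums \<beta> \<subseteq> {1..<n}" by (rule part_sums_subset[OF \<beta>])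
      have "0 = (\<Sum>\<alpha>\<in>J. u (QF \<alpha>) * QF \<alpha> (packed_mono n (part_sums \<beta>)))"
        using fun_cong[OF 0, of "packed_mono n (part_sums \<beta>)"]
        by (simp add: J(2) sum.reindex[OF injJ] sum_fun_apply fscale_apply)
      also have "\<dots> = (\<Sum>\<alpha>\<in>J. if \<alpha> = \<beta> then u (QF \<beta>) else 0)"
      proof (rule sum.cong[OF refl])
        fix \<alpha> assume \<alpha>: "\<alpha> \<in> J"
        show "u (QF \<alpha>) * QF \<alpha> (packed_mono n (part_sums \<beta>)) = (if \<alpha> = \<beta> then u (QF \<beta>) else 0)"
        proof (cases "\<alpha> \<in> Comp n \<and> part_sums \<alpha> \<subseteq> part_sums \<beta> \<and> \<alpha> \<noteq> \<beta>")
          case True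
          then have "part_sums \<alpha> \<subset> part_sums \<beta>" using part_sums_inj[of \<alpha> n \<beta>] \<beta> by blast
          then have "card (part_sums \<alpha>) < card (part_sums \<beta>)"
            using S by (intro psubset_card_mono) (auto intro: finite_subset)
          then show ?thesis using less.hyps \<alpha> True by simp
        next
          case False
          moreover have "\<alpha> \<in> Comps" using \<alpha> J by auto
          ultimately show ?thesis using QF_Comps_packed_mono[of \<alpha>, OF _ S] \<beta> by auto
        qed
      qed
      also have "\<dots> = u (QF \<beta>)" using less.prems finJ by simp
      finally show ?case by simp
    qed
    then show "u v = 0" using v J by auto
  qed
qed

text \<open>\<open>QF \<alpha>\<close> is \<open>QM \<alpha>\<close> plus strictly finer terms;
  induction from the finest composition downwards inverts this.\<close>

lemma Qdeg_span_QF: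
  assumes "v \<in> Qdeg n"
  shows "v \<in> fvs.span (QF ` Comp n)"
proof -
  have "QM \<alpha> \<in> fvs.span (QF ` Comp n)" if "\<alpha> \<in> Comp n" for \<alpha>
    using that
  proof (induction "n - card (part_sums \<alpha>)" arbitrary: \<alpha> rule: less_induct)
    case less
    let ?C = "{\<beta> \<in> Comp n. part_sums \<alpha> \<subseteq> part_sums \<beta>}"
    have "QF \<alpha> = QM \<alpha> + (\<Sum>\<beta>\<in>?C - {\<alpha>}. QM \<beta>)"
      unfolding QF_def sum_list_Comp[OF less.prems] using less.prems by (subst sum.remove[of _ \<alpha>]) auto
    then have "QM \<alpha> = QF \<alpha> - (\<Sum>\<beta>\<in>?C - {\<alpha>}. QM \<beta>)" by simp
    also have "\<dots> \<in> fvs.span (QF ` Comp n)"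
    proof (intro fvs.span_diff fvs.span_sum)
      show "QF \<alpha> \<in> fvs.span (QF ` Comp n)" using less.prems by (auto intro: fvs.span_base)
      fix \<beta> assume \<beta>: "\<beta> \<in> ?C - {\<alpha>}"
      then have "part_sums \<alpha> \<subset> part_sums \<beta>" using part_sums_inj[of \<alpha> n \<beta>] less.prems by blast
      moreover have "part_sums \<beta> \<subseteq> {1..<n}" using \<beta> part_sums_subset by auto
      ultimately have "card (part_sums \<alpha>) < card (part_sums \<beta>)" "card (part_sums \<beta>) \<le> card {1..<n}"
        by (meson psubset_card_mono card_mono finite_subset finite_atLeastLessThan)+
      then show "QM \<beta> \<in> fvs.span (QF ` Comp n)" using \<beta> by (intro less.hyps) auto
    qed
    finally show ?case .
  qed
  then have "fvs.span (QM ` Comp n) \<subseteq> fvs.span (QF ` Comp n)"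
    by (intro fvs.span_minimal fvs.subspace_span) auto
  then show ?thesis using assms unfolding Qdeg_def by auto
qed

text \<open>Among the fundamental functions only that of \<open>one_row n\<close> is nonzero at this
  point, so the coordinate is read off without inverting the triangular system.\<close>

lemma coord_QF_one_row:
  assumes "v \<in> Qdeg n"
  shows "coord QF Comps v (one_row n) = v (packed_mono n {})"
proof -
  let ?X = "{\<alpha> \<in> Comps. coord QF Comps v \<alpha> \<noteq> 0}"
  have "v \<in> fvs.span (QF ` Comps)"
    using Qdeg_span_QF[OF assms] fvs.span_mono[of "QF ` Comp n" "QF ` Comps"] Comp_Comps by auto
  then have "v (packed_mono n {}) = (\<Sum>\<alpha>\<in>?X. coord QF Comps v \<alpha> * QF \<alpha> (packed_mono n {}))"
    using sum_coord[OF QF_independent, of v] by (metis (no_types, lifting) sum_fun_apply fscale_apply sum.cong)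
  also have "\<dots> = (\<Sum>\<alpha>\<in>?X. if \<alpha> = one_row n then coord QF Comps v (one_row n) else 0)"
  proof (rule sum.cong[OF refl])
    fix \<alpha> assume "\<alpha> \<in> ?X"
    moreover have "\<alpha> \<in> Comp n \<and> part_sums \<alpha> \<subseteq> {} \<longleftrightarrow> \<alpha> = one_row n"
      using part_sums_inj[of \<alpha> n "one_row n"] one_row_Comp[of n] by auto
    ultimately show "coord QF Comps v \<alpha> * QF \<alpha> (packed_mono n {}) = (if \<alpha> = one_row n then coord QF Comps v (one_row n) else 0)"
      using QF_Comps_packed_mono[of \<alpha> "{}" n] by auto
  qed
  also have "\<dots> = coord QF Comps v (one_row n)"
    using finite_coord_support[OF QF_inj, of v] one_row_Comp[of n] by (auto simp: Comp_Comps)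
  finally show ?thesis ..
qed

lemma (in qsym_endomorphism) cmat_one_row: "cmat \<Phi> (Dcomp n \<sigma>) (one_row n) = chi n \<sigma>"
  unfolding cmat_def chi_def QF_Dcomp by (intro coord_QF_one_row Phi_Qdeg F_Qdeg)


section \<open>Generation of the symmetric group by a descent class\<close>

definition rev_perm :: "nat \<Rightarrow> nat \<Rightarrow> nat" where
  "rev_perm n i = (if i \<in> {1..n} then n + 1 - i else i)"

lemma rev_perm_invol [simp]: "rev_perm n (rev_perm n i) = i"
  by (auto simp: rev_perm_def)

lemma rev_perm_comp [simp]: "rev_perm n \<circ> rev_perm n = id" "rev_perm n \<circ> (rev_perm n \<circ> \<sigma>) = \<sigma>"
  by (auto simp: fun_eq_iff)

lemma rev_perm_permutes: "rev_perm n permutes {1..n}"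
  by (rule bij_imp_permutes, rule bij_betw_byWitness[where f' = "rev_perm n"])
    (auto simp: rev_perm_def)

lemma Des_rev_perm_comp:
  assumes "\<sigma> permutes {1..n}"
  shows "Des n (rev_perm n \<circ> \<sigma>) = {1..<n} - Des n \<sigma>"
proof -
  have "rev_perm n (\<sigma> (i + 1)) < rev_perm n (\<sigma> i) \<longleftrightarrow> \<not> \<sigma> (i + 1) < \<sigma> i" if i: "i \<in> {1..<n}" for i
  proof -
    have "\<sigma> i \<in> {1..n}" "\<sigma> (i + 1) \<in> {1..n}" using permutes_in_image[OF assms] i by auto
    moreover have "\<sigma> i \<noteq> \<sigma> (i + 1)"
      using permutes_inj[OF assms] by (metis add_eq_self_zero injD zero_neq_one)
    ultimately show ?thesis by (auto simp: rev_perm_def)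
  qed
  then show ?thesis by (auto simp: Des_def)
qed

lemma Des_empty_imp_id:
  assumes \<sigma>: "\<sigma> permutes {1..n}" and "Des n \<sigma> = {}"
  shows "\<sigma> = id"
proof
  fix i
  have "\<sigma> i < \<sigma> (i + 1)" if i: "i \<in> {1..<n}" for i
  proof -
    have "\<sigma> i \<noteq> \<sigma> (i + 1)"
      using permutes_inj[OF \<sigma>] by (metis add_eq_self_zero injD zero_neq_one)
    moreover have "i \<notin> Des n \<sigma>" using assms(2) by simp
    ultimately show ?thesis using i by (auto simp: Des_def)
  qed
  then have *: "a < b \<longleftrightarrow> \<sigma> a < \<sigma> b" if "a \<in> {1..n}" "b \<in> {1..n}" for a b
    using mono_chain_iff[of n \<sigma>] that by blast
  show "\<sigma> i = id i"
  proof (cases "i \<in> {1..n}")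
    case True
    have "{j \<in> {1..n}. \<sigma> j \<le> \<sigma> i} = {1..i}"
    proof -
      have "\<sigma> j \<le> \<sigma> i \<longleftrightarrow> j \<le> i" if "j \<in> {1..n}" for j
        using *[OF True that] by linarith
      then show ?thesis using True by auto
    qed
    then show ?thesis using permutes_eq_card[OF \<sigma> True] by simp
  qed (use permutes_not_in[OF \<sigma>] in simp)
qed

lemma Des_full_imp_rev:
  assumes \<sigma>: "\<sigma> permutes {1..n}" and "Des n \<sigma> = {1..<n}"
  shows "\<sigma> = rev_perm n"
proof -
  have "rev_perm n \<circ> \<sigma> = id"
    using assms by (intro Des_empty_imp_id[of _ n] permutes_compose[OF \<sigma> rev_perm_permutes]) (simp add: Des_rev_perm_comp)
  then have "rev_perm n \<circ> (rev_perm n \<circ> \<sigma>) = rev_perm n" by simp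
  then show ?thesis by simp
qed

lemma transpose_adjacent_less_iff:
  fixes p q k :: nat
  assumes "{p, q} \<noteq> {k, k + 1}"
  shows "transpose k (k + 1) p < transpose k (k + 1) q \<longleftrightarrow> p < q"
  using assms by (auto simp: transpose_def)

text \<open>
  An interior position \<open>j\<close> that is a peak (valley) of the descent pattern can carry the largest
  (smallest) value \<open>x\<close>, and the values \<open>k\<close>, \<open>k + 1\<close> can be put on different sides of \<open>j\<close>; exchanging
  them does not affect the descents.
\<close>
lemma ex_two_perms_same_Des:
  assumes S: "S \<subseteq> {1..<n}" and j: "1 < j" "j < n"
    and x: "(x = n \<and> j - 1 \<notin> S \<and> j \<in> S) \<or> (x = 1 \<and> j - 1 \<in> S \<and> j \<notin> S)"
    and k: "k \<in> {1..n} - {x}" "k + 1 \<in> {1..n} - {x}"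
  shows "\<exists>w. w permutes {1..n} \<and> Des n w = S \<and> w j = x \<and> Des n (transpose k (k + 1) \<circ> w) = S"
proof -
  define B where "B = {1..n} - {x}"
  have xn: "x \<in> {1..n}" using x j by auto
  have cB: "card B = n - 1" using xn by (simp add: B_def)
  \<comment> \<open>The \<open>j - 1\<close> places left of \<open>j\<close> receive
    \<open>k\<close> and \<open>j - 2\<close> values other than \<open>k\<close> and
    \<open>k + 1\<close>; this sends \<open>k + 1\<close> to the right. Enough values remain because
    \<open>j < n\<close>.\<close>
  have "j - 2 \<le> card (B - {k, k + 1})"
    using k cB j by (simp add: B_def card_Diff_subset)
  then obtain L' where L': "L' \<subseteq> B - {k, k + 1}" "card L' = j - 2" "finite L'"
    using obtain_subset_with_card_n by metis
  define L where "L = insert k L'"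
  define R where "R = B - L"
  have L: "L \<subseteq> B" "finite L" "card L = j - 1" "k \<in> L" "k + 1 \<notin> L"
    using L' k j by (auto simp: L_def B_def card_insert_if)
  have R: "finite R" "card R = n - j" "k \<notin> R"
    using L cB by (auto simp: R_def B_def card_Diff_subset)
  obtain gL where gL: "bij_betw gL {1..<1 + (j - 1)} L"
    "\<And>i. 1 \<le> i \<Longrightarrow> i + 1 < 1 + (j - 1) \<Longrightarrow> gL (i + 1) < gL i \<longleftrightarrow> i \<in> S"
    using ex_arrangement_with_descents[OF L(2,3), of 1 S] by auto
  obtain gR where gR: "bij_betw gR {j + 1..<j + 1 + (n - j)} R"
    "\<And>i. j + 1 \<le> i \<Longrightarrow> i + 1 < j + 1 + (n - j) \<Longrightarrow> gR (i + 1) < gR i \<longleftrightarrow> i \<in> S"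
    using ex_arrangement_with_descents[OF R(1,2), of "j + 1" S] by auto
  define w where "w = (\<lambda>i. if i \<in> {1..<j} then gL i else if i = j then x else if i \<in> {j + 1..n} then gR i else i)"
  have wL: "bij_betw w {1..<j} L"
  proof (rule bij_betw_cong[THEN iffD1])
    show "bij_betw gL {1..<j} L" using gL(1) j by simp
  qed (auto simp: w_def)
  have wR: "bij_betw w {j + 1..n} R"
  proof (rule bij_betw_cong[THEN iffD1])
    show "bij_betw gR {j + 1..n} R" using gR(1) j by (simp add: atLeastLessThanSuc_atLeastAtMost)
  qed (auto simp: w_def)
  have wj: "w j = x" by (simp add: w_def)
  have xLR: "x \<notin> L" "x \<notin> R" using L(1) by (auto simp: R_def B_def)
  have "bij_betw w ({1..<j} \<union> {j} \<union> {j + 1..n}) (L \<union> {x} \<union> R)"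
  proof (intro bij_betw_combine wL wR)
    show "bij_betw w {j} {x}" by (simp add: bij_betw_def wj)
  qed (use xLR in \<open>auto simp: R_def\<close>)
  moreover have "{1..<j} \<union> {j} \<union> {j + 1..n} = {1..n}" using j by auto
  moreover have "L \<union> {x} \<union> R = {1..n}" using L(1) xn by (auto simp: R_def B_def)
  ultimately have "bij_betw w {1..n} {1..n}" by simp
  then have perm: "w permutes {1..n}"
    by (rule bij_imp_permutes) (use j in \<open>auto simp: w_def\<close>)
  have inL: "w i \<in> L" if "i \<in> {1..<j}" for i using wL that by (auto simp: bij_betw_def)
  have inR: "w i \<in> R" if "i \<in> {j + 1..n}" for i using wR that by (auto simp: bij_betw_def)
  \<comment> \<open>With an extreme value at \<open>j\<close>, both comparisons with its neighbours
    come out right whichever values sit there.\<close>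
  have B_x: "(y < x \<longleftrightarrow> j \<in> S) \<and> (x < y \<longleftrightarrow> j - 1 \<in> S)" if "y \<in> B" for y
    using that x by (auto simp: B_def)
  have des: "w (i + 1) < w i \<longleftrightarrow> i \<in> S" if i: "1 \<le> i" "i < n" for i
  proof -
    consider "i + 1 < j" | "i + 1 = j" | "i = j" | "j < i" using nat_neq_iff[of "i + 1" j] by linarith
    then show ?thesis
    proof cases
      case 1
      then show ?thesis using gL(2)[of i] i by (simp add: w_def)
    next
      case 2
      then have "w i \<in> B" using inL[of i] L(1) i by auto
      then show ?thesis using B_x[of "w i"] 2 wj by auto
    next
      case 3
      then have "w (i + 1) \<in> B" using inR[of "i + 1"] i by (auto simp: R_def)
      then show ?thesis using B_x[of "w (i + 1)"] 3 wj by auto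
    next
      case 4
      then show ?thesis using gR(2)[of i] i j by (simp add: w_def)
    qed
  qed
  have Des_w: "Des n w = S"
    using des S by (force simp: Des_def)
  have xk: "x \<notin> {k, k + 1}" using k by auto
  have "{w i, w (i + 1)} \<noteq> {k, k + 1}" if i: "1 \<le> i" "i < n" for i
  proof -
    consider "i + 1 < j" | "i + 1 = j" | "i = j" | "j < i" using nat_neq_iff[of "i + 1" j] by linarith
    then show ?thesis
    proof cases
      case 1
      then have "{w i, w (i + 1)} \<subseteq> L" using inL[of i] inL[of "i + 1"] i by simp
      then show ?thesis using L(5) by blast
    next
      case 2
      then show ?thesis using wj xk by (metis insertCI)
    next
      case 3
      then show ?thesis using wj xk by (metis insertCI)
    next
      case 4
      then have "{w i, w (i + 1)} \<subseteq> R" using inR[of i] inR[of "i + 1"] i by simp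
      then show ?thesis using R(3) by blast
    qed
  qed
  then have "transpose k (k + 1) (w (i + 1)) < transpose k (k + 1) (w i) \<longleftrightarrow> w (i + 1) < w i"
    if "1 \<le> i" "i < n" for i
    using transpose_adjacent_less_iff[of "w (i + 1)" "w i" k] that by (simp only: insert_commute) simp
  then have "Des n (transpose k (k + 1) \<circ> w) = Des n w"
    by (auto simp: Des_def)
  then show ?thesis using perm Des_w wj by auto
qed

text \<open>Two permutations of the class differing by an adjacent transposition of values show that
  this transposition stabilizes \<open>Z\<close>. This yields all transpositions avoiding one
  extreme value \<open>x\<close>; conjugation yields those avoiding a position
  \<open>j \<noteq> x\<close>, and together they generate the group. The form with a closed set
  \<open>Z\<close> suits the zero set of an invariant vector.\<close>

lemma descent_class_generates:
  assumes S: "S \<subseteq> {1..<n}" "S \<noteq> {}" "S \<noteq> {1..<n}"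
    and Z: "Z \<subseteq> {\<sigma>. \<sigma> permutes {1..n}}" "Z \<noteq> {}"
    and closed: "\<And>w z. w permutes {1..n} \<Longrightarrow> Des n w = S \<Longrightarrow> z \<in> Z \<Longrightarrow> w \<circ> z \<in> Z"
  shows "Z = {\<sigma>. \<sigma> permutes {1..n}}"
proof -
  have finZ: "finite Z" using Z(1) by (rule finite_subset) (simp add: finite_permutations)
  \<comment> \<open>\<open>H\<close> is the stabilizer of \<open>Z\<close> under left
    multiplication, hence a group; finiteness of \<open>Z\<close> upgrades \<open>closed\<close>
    from inclusion to equality.\<close>
  define H where "H = {h. h permutes {1..n} \<and> (\<lambda>z. h \<circ> z) ` Z = Z}"
  have H_comp: "g \<circ> h \<in> H" if "g \<in> H" "h \<in> H" for g h
  proof -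
    have "(\<lambda>z. (g \<circ> h) \<circ> z) ` Z = (\<lambda>z. g \<circ> z) ` ((\<lambda>z. h \<circ> z) ` Z)"
      by (simp add: image_image o_assoc)
    then show ?thesis using that by (simp add: H_def permutes_compose)
  qed
  have H_inv: "inv h \<in> H" if "h \<in> H" for h
  proof -
    have h: "h permutes {1..n}" "(\<lambda>z. h \<circ> z) ` Z = Z" using that by (auto simp: H_def)
    have "(\<lambda>z. inv h \<circ> z) ` Z = (\<lambda>z. inv h \<circ> z) ` ((\<lambda>z. h \<circ> z) ` Z)" by (simp add: h(2))
    also have "\<dots> = Z"
      by (simp add: image_image o_assoc permutes_inv_o(2)[OF h(1)])
    finally show ?thesis using h by (simp add: H_def permutes_inv)
  qed
  have H_Des: "w \<in> H" if w: "w permutes {1..n}" "Des n w = S" for w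
  proof -
    have "inj_on (\<lambda>z. w \<circ> z) Z"
      using permutes_inj[OF w(1)] by (auto simp: inj_on_def fun_eq_iff dest: injD)
    moreover have "(\<lambda>z. w \<circ> z) ` Z \<subseteq> Z" using closed[OF w] by auto
    ultimately show ?thesis using w(1) endo_inj_surj[OF finZ] by (simp add: H_def)
  qed
  \<comment> \<open>A nonempty proper \<open>S\<close> has membership changing somewhere between
    neighbours; the position \<open>i + 1\<close> is then a peak or a valley.\<close>
  obtain i where i: "i \<in> {1..<n - 1}" "(i \<in> S) \<noteq> (i + 1 \<in> S)"
  proof -
    have "\<exists>i\<in>{1..<n - 1}. (i \<in> S) \<noteq> (i + 1 \<in> S)"
    proof (rule ccontr)
      assume "\<not> ?thesis"
      then have *: "i \<in> S \<longleftrightarrow> i + 1 \<in> S" if "i \<in> {1..<n - 1}" for i using that by blast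
      have "1 \<le> i \<Longrightarrow> i < n \<Longrightarrow> i \<in> S \<longleftrightarrow> 1 \<in> S" for i
      proof (induction i rule: dec_induct)
        case (step i)
        then show ?case using *[of i] by auto
      qed auto
      then show False using S by (cases "1 \<in> S") force+
    qed
    then show thesis using that by blast
  qed
  define j where "j = i + 1"
  define x where "x = (if i \<in> S then 1 else n)"
  have j: "1 < j" "j < n" using i by (auto simp: j_def)
  have x: "(x = n \<and> j - 1 \<notin> S \<and> j \<in> S) \<or> (x = 1 \<and> j - 1 \<in> S \<and> j \<notin> S)"
    using i by (auto simp: x_def j_def)
  have adj: "transpose k (k + 1) \<in> H" "\<exists>w\<in>H. w j = x" if k: "k \<in> {1..n} - {x}" "k + 1 \<in> {1..n} - {x}" for k
  proof -
    obtain w where w: "w permutes {1..n}" "Des n w = S" "w j = x" "Des n (transpose k (k + 1) \<circ> w) = S"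
      using ex_two_perms_same_Des[OF S(1) j x k] by blast
    let ?s = "transpose k (k + 1)"
    have "?s permutes {1..n}" using k by (intro permutes_swap_id) auto
    then have sw: "?s \<circ> w permutes {1..n}" by (rule permutes_compose[OF w(1)])
    have "(?s \<circ> w) \<circ> inv w \<in> H"
      by (rule H_comp[OF H_Des[OF sw w(4)] H_inv[OF H_Des[OF w(1,2)]]])
    then show "?s \<in> H" by (simp add: o_assoc[symmetric] permutes_inv_o(1)[OF w(1)])
    show "\<exists>w\<in>H. w j = x" using H_Des w by blast
  qed
  have H_trans: "transpose a c \<in> H"
    if "transpose a b \<in> H" "transpose b c \<in> H" "a \<noteq> c" "b \<noteq> c" for a b c
    using H_comp[OF H_comp[OF that(1,2)] that(1)] transpose_comp_triple[OF that(3,4)] by simp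
  have H_id: "id \<in> H" by (simp add: H_def permutes_id)
  have less_x: "a < b \<Longrightarrow> a \<in> {1..n} - {x} \<Longrightarrow> b \<in> {1..n} - {x} \<Longrightarrow> transpose a b \<in> H" for a b
  proof (induction b)
    case (Suc b)
    show ?case
    proof (cases "a = b")
      case True
      then show ?thesis using adj(1)[of b] Suc.prems by simp
    next
      case False
      then have "b \<in> {1..n} - {x}" using Suc.prems x by auto
      then show ?thesis
        using H_trans[of a b "Suc b"] Suc adj(1)[of b] False by auto
    qed
  qed auto
  have off_x: "transpose a b \<in> H" if "a \<in> {1..n} - {x}" "b \<in> {1..n} - {x}" for a b
    using less_x[of a b] less_x[of b a] that H_id
    by (cases a b rule: linorder_cases) (simp_all add: transpose_commute)
  obtain w where w: "w \<in> H" "w j = x"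
  proof -
    have "\<exists>k. k \<in> {1..n} - {x} \<and> k + 1 \<in> {1..n} - {x}"
      using x j by (intro exI[of _ "if x = 1 then 2 else 1"]) auto
    then show thesis using adj(2) that by blast
  qed
  have wp: "w permutes {1..n}" using w by (simp add: H_def)
  \<comment> \<open>Conjugation by a \<open>w\<close> in \<open>H\<close> with
    \<open>w j = x\<close> moves the omitted point from \<open>x\<close> to
    \<open>j\<close>.\<close>
  have off_j: "transpose a b \<in> H" if "a \<in> {1..n} - {j}" "b \<in> {1..n} - {j}" for a b
  proof -
    have "w a \<noteq> x" "w b \<noteq> x"
      using that w(2) permutes_inj[OF wp] by (auto dest: injD)
    then have "transpose (w a) (w b) \<in> H"
      using that permutes_in_image[OF wp] by (intro off_x) auto
    then have "inv w \<circ> (transpose (w a) (w b) \<circ> w) \<in> H"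
      using H_comp[OF H_inv[OF w(1)] H_comp[OF _ w(1)]] by blast
    moreover have "transpose (w a) (w b) \<circ> w = w \<circ> transpose a b"
      using permutes_inj[OF wp] by (auto simp: fun_eq_iff transpose_def dest: injD)
    ultimately show ?thesis by (simp add: o_assoc permutes_inv_o(2)[OF wp])
  qed
  \<comment> \<open>The only transposition avoiding neither \<open>x\<close> nor \<open>j\<close> is
    obtained through a third point, which exists since \<open>1 < j < n\<close>.\<close>
  have xj: "transpose x j \<in> H"
  proof -
    obtain y where y: "y \<in> {1..n}" "y \<noteq> x" "y \<noteq> j"
    proof -
      have "\<exists>y. y \<in> {1..n} \<and> y \<noteq> x \<and> y \<noteq> j"
        using x j by (intro exI[of _ "if x = 1 then n else 1"]) auto
      then show thesis using that by blast
    qed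
    have "x \<noteq> j" "x \<in> {1..n}" using x j by auto
    then show ?thesis
      using H_trans[of x y j] off_j[of x y] off_x[of y j] y j by auto
  qed
  have all: "transpose a b \<in> H" if "a \<in> {1..n}" "b \<in> {1..n}" for a b
  proof -
    have "x \<noteq> j" using x j by auto
    then consider "a \<noteq> x" "b \<noteq> x" | "a \<noteq> j" "b \<noteq> j" | "a = b" | "a = x" "b = j" | "a = j" "b = x"
      by blast
    then show ?thesis
    proof cases
      case 5
      then show ?thesis using xj by (simp add: transpose_commute)
    qed (use off_x[of a b] off_j[of a b] xj H_id that in auto)
  qed
  have P_H: "\<sigma> \<in> H" if "\<sigma> permutes {1..n}" for \<sigma>
    using that by (induction rule: permutes_induct[OF that]) (use H_id all H_comp in auto)
  obtain z where z: "z \<in> Z" using Z(2) by auto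
  have zp: "z permutes {1..n}" using z Z(1) by auto
  have "\<sigma> \<in> Z" if \<sigma>: "\<sigma> permutes {1..n}" for \<sigma>
  proof -
    have "\<sigma> \<circ> inv z \<in> H" using \<sigma> zp by (intro P_H permutes_compose permutes_inv)
    then have "(\<sigma> \<circ> inv z) \<circ> z \<in> Z" using z by (auto simp: H_def)
    then show ?thesis by (simp add: o_assoc[symmetric] permutes_inv_o(2)[OF zp])
  qed
  then show ?thesis using Z(1) by auto
qed


section \<open>The chain as a lumped random walk\<close>

locale partitioned_endomorphism = qsym_endomorphism +
  fixes n :: nat and r :: "(nat list \<times> nat list) set" and E :: "nat list set set"
  assumes partitioning: "partitioning \<Phi> n r"
    and E_eq: "E = Comp n // r"
    and cmat_nonneg: "\<And>\<alpha>. \<alpha> \<in> Comp n \<Longrightarrow> cmat \<Phi> \<alpha> (one_row n) \<ge> 0"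
    and cmat_nonzero: "\<exists>\<alpha>\<in>Comp n. cmat \<Phi> \<alpha> (one_row n) \<noteq> 0"
begin

abbreviation P :: "(nat \<Rightarrow> nat) set" where
  "P \<equiv> {\<sigma>. \<sigma> permutes {1..n}}"

definition cls :: "(nat \<Rightarrow> nat) \<Rightarrow> nat list set" where
  "cls \<sigma> = r `` {Dcomp n \<sigma>}"

definition q :: "(nat \<Rightarrow> nat) \<Rightarrow> real" where
  "q \<sigma> = of_rat (chi n \<sigma> / lam \<Phi> ^ n)"

lemma finite_P: "finite P"
  by (simp add: finite_permutations)

lemma equiv_r: "equiv (Comp n) r"
  using partitioning by (simp add: partitioning_def)

lemma cls_in_E: "cls \<sigma> \<in> E"
  unfolding cls_def E_eq by (intro quotientI Dcomp_in_Comp)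

lemma ex_Dcomp: "\<alpha> \<in> Comp n \<Longrightarrow> \<exists>\<sigma>\<in>P. Dcomp n \<sigma> = \<alpha>"
  using ex_permutes_Des[OF part_sums_subset] by (auto simp: Dcomp_eq_iff)

lemma ex_cls: "A \<in> E \<Longrightarrow> \<exists>\<sigma>\<in>P. cls \<sigma> = A"
  unfolding E_eq cls_def using ex_Dcomp by (metis quotientE)

lemma finite_E: "finite E"
  by (rule finite_subset[of _ "cls ` P"]) (use ex_cls finite_P in auto)

lemma Dcomp_in_iff: "A \<in> E \<Longrightarrow> Dcomp n \<sigma> \<in> A \<longleftrightarrow> cls \<sigma> = A"
  unfolding E_eq cls_def
  using equiv_class_self[OF equiv_r Dcomp_in_Comp] equiv_class_eq_iff[OF equiv_r]
  by (metis (no_types, lifting) Image_singleton_iff quotientE)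

text \<open>\<open>\<Phi>\<close> is constant on classes, so the representative picked by
  \<open>SOME\<close> does not matter.\<close>

lemma class_val_cls: "class_val \<Phi> (cls \<sigma>) = \<Phi> (F n (Des n \<sigma>))"
proof -
  have "Dcomp n \<sigma> \<in> cls \<sigma>" using Dcomp_in_iff[OF cls_in_E] by simp
  then have "(SOME \<alpha>. \<alpha> \<in> cls \<sigma>) \<in> cls \<sigma>" by (rule someI)
  then have "(Dcomp n \<sigma>, SOME \<alpha>. \<alpha> \<in> cls \<sigma>) \<in> r" by (simp add: cls_def)
  then have "\<Phi> (QF (Dcomp n \<sigma>)) = \<Phi> (QF (SOME \<alpha>. \<alpha> \<in> cls \<sigma>))"
    using partitioning unfolding partitioning_def by blast
  then show ?thesis by (simp add: class_val_def QF_Dcomp)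
qed

text \<open>Applying \<open>\<Phi>\<close> once more to the expansion of
  \<open>\<Phi> (F n (Des n \<pi>))\<close> turns each \<open>F n (Des n \<tau>)\<close> into the
  basis vector of \<open>cls \<tau>\<close>; grouping by class gives the coefficients. Lumpability
  is automatic, as the left side depends only on \<open>cls \<pi>\<close>.\<close>

lemma Khat_eq:
  assumes \<pi>: "\<pi> \<in> P" and B: "B \<in> E"
  shows "of_rat (Khat \<Phi> n E (cls \<pi>) B) = (\<Sum>\<tau>\<in>{\<tau> \<in> P. cls \<tau> = B}. q (\<pi> \<circ> inv \<tau>))"
proof -
  let ?c = "\<lambda>\<tau>. chi n (\<pi> \<circ> inv \<tau>)"
  let ?s = "\<lambda>A. \<Sum>\<tau>\<in>{\<tau> \<in> P. cls \<tau> = A}. ?c \<tau>"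
  have "basis_of (class_val \<Phi>) E (\<Phi> ` Qdeg n)"
    using partitioning by (simp add: partitioning_def E_eq)
  then have inj: "inj_on (class_val \<Phi>) E" and ind: "fvs.independent (class_val \<Phi> ` E)"
    by (simp_all add: basis_of_def)
  have FQ: "F n D \<in> QSym" for D using F_Qdeg Qdeg_QSym by blast
  have "\<Phi> (class_val \<Phi> (cls \<pi>)) = \<Phi> (\<Sum>\<tau>\<in>P. fscale (?c \<tau>) (F n (Des n \<tau>)))"
    using Phi_F_expansion \<pi> by (simp only: class_val_cls mem_Collect_eq)
  also have "\<dots> = (\<Sum>\<tau>\<in>P. \<Phi> (fscale (?c \<tau>) (F n (Des n \<tau>))))"
    using FQ by (intro Phi_sum) (auto simp: QSym_def intro: fvs.span_scale)
  also have "\<dots> = (\<Sum>\<tau>\<in>P. fscale (?c \<tau>) (class_val \<Phi> (cls \<tau>)))"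
    using FQ by (simp only: Phi_scale class_val_cls)
  also have "\<dots> = (\<Sum>A\<in>E. \<Sum>\<tau>\<in>{\<tau> \<in> P. cls \<tau> = A}. fscale (?c \<tau>) (class_val \<Phi> (cls \<tau>)))"
    using finite_P finite_E cls_in_E by (intro sum.group[symmetric]) auto
  also have "\<dots> = (\<Sum>A\<in>E. fscale (?s A) (class_val \<Phi> A))"
    by (intro sum.cong refl) (auto simp: fvs.scale_sum_left intro!: sum.cong)
  finally have "dmat \<Phi> E (cls \<pi>) B = ?s B"
    unfolding dmat_def using coord_sum[OF inj ind subset_refl finite_E B, of ?s] B by simp
  then show ?thesis
    by (simp add: Khat_def q_def of_rat_divide of_rat_sum of_rat_power sum_divide_distrib)
qed

section \<open>Positivity and stationarity of the lumped uniform distribution\<close>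

lemma chi_nonneg: "chi n \<sigma> \<ge> 0"
  using cmat_nonneg[OF Dcomp_in_Comp] by (simp add: cmat_one_row)

text \<open>By \<open>sum_chi\<close> this power is a sum of nonnegative values of
  \<open>chi\<close>, at least one of them nonzero.\<close>

lemma lam_power_pos: "lam \<Phi> ^ n > 0"
proof -
  obtain \<alpha> where "\<alpha> \<in> Comp n" "cmat \<Phi> \<alpha> (one_row n) \<noteq> 0" using cmat_nonzero by blast
  then obtain \<sigma> where \<sigma>: "\<sigma> \<in> P" "chi n \<sigma> \<noteq> 0" using ex_Dcomp cmat_one_row by metis
  then have "0 < chi n \<sigma>" using chi_nonneg[of \<sigma>] by simp
  also have "chi n \<sigma> \<le> (\<Sum>\<sigma>\<in>P. chi n \<sigma>)"
    using \<sigma> chi_nonneg finite_P by (intro member_le_sum) auto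
  finally show ?thesis by (simp only: sum_chi)
qed

lemma lam_power_divide_self: "lam \<Phi> ^ n / lam \<Phi> ^ n = 1"
  by (rule divide_self) (use lam_power_pos in \<open>rule less_imp_neq[symmetric]\<close>)

lemma q_nonneg: "q \<sigma> \<ge> 0"
  unfolding q_def using chi_nonneg lam_power_pos by (simp add: less_imp_le)

lemma sum_q: "(\<Sum>\<sigma>\<in>P. q \<sigma>) = 1"
proof -
  have "(\<Sum>\<sigma>\<in>P. q \<sigma>) = of_rat ((\<Sum>\<sigma>\<in>P. chi n \<sigma>) / lam \<Phi> ^ n)"
    by (simp add: q_def of_rat_sum sum_divide_distrib)
  then show ?thesis unfolding sum_chi lam_power_divide_self by simp
qed

lemma sum_over_classes: "(\<Sum>A\<in>E. \<Sum>\<sigma>\<in>{\<sigma> \<in> P. cls \<sigma> = A}. f \<sigma>) = (\<Sum>\<sigma>\<in>P. f \<sigma> :: real)"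
  using finite_P finite_E cls_in_E by (intro sum.group) auto

lemma lumped_uniform_eq:
  "A \<in> E \<Longrightarrow> lumped_uniform n E A = (\<Sum>\<sigma>\<in>{\<sigma> \<in> P. cls \<sigma> = A}. 1 / fact n)"
  using Dcomp_in_iff by (simp add: lumped_uniform_def)

lemma lumped_uniform_pos: "A \<in> E \<Longrightarrow> lumped_uniform n E A > 0"
  using ex_cls[of A] finite_P by (auto simp: lumped_uniform_eq card_gt_0_iff)

text \<open>The walk on permutations is doubly stochastic: for fixed \<open>\<tau>\<close>, right
  translation by \<open>inv \<tau>\<close> permutes the group, so the weights arriving at
  \<open>\<tau>\<close> also sum to 1.\<close>

lemma stationary_lumped_uniform: "stationary E (Khat \<Phi> n E) (lumped_uniform n E)"
  unfolding stationary_def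
proof (intro conjI ballI)
  show "lumped_uniform n E \<in> E \<rightarrow>\<^sub>E {0..}"
    by (auto simp: lumped_uniform_def)
  show "(\<Sum>A\<in>E. lumped_uniform n E A) = 1"
  proof -
    have "(\<Sum>A\<in>E. lumped_uniform n E A) = (\<Sum>A\<in>E. \<Sum>\<sigma>\<in>{\<sigma> \<in> P. cls \<sigma> = A}. 1 / fact n)"
      by (intro sum.cong refl lumped_uniform_eq)
    also have "\<dots> = 1"
      unfolding sum_over_classes using card_permutations[of "{1..n}" n] by simp
    finally show ?thesis .
  qed
next
  fix B assume B: "B \<in> E"
  have unif: "(\<Sum>\<pi>\<in>P. q (\<pi> \<circ> inv \<tau>)) = 1" if "\<tau> \<in> P" for \<tau>
  proof -
    have \<tau>: "\<tau> permutes {1..n}" using that by simp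
    have "(\<Sum>\<pi>\<in>P. q (\<pi> \<circ> inv \<tau>)) = (\<Sum>\<sigma>\<in>P. q \<sigma>)"
      by (rule sum.reindex_bij_witness[of _ "\<lambda>\<sigma>. \<sigma> \<circ> \<tau>" "\<lambda>\<pi>. \<pi> \<circ> inv \<tau>"])
        (simp_all add: o_assoc[symmetric] permutes_inv_o[OF \<tau>] permutes_compose permutes_inv \<tau>[simplified])
    then show ?thesis by (simp only: sum_q)
  qed
  have "(\<Sum>A\<in>E. lumped_uniform n E A * of_rat (Khat \<Phi> n E A B))
      = (\<Sum>A\<in>E. \<Sum>\<pi>\<in>{\<pi> \<in> P. cls \<pi> = A}. (\<Sum>\<tau>\<in>{\<tau> \<in> P. cls \<tau> = B}. q (\<pi> \<circ> inv \<tau>)) / fact n)"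
  proof (intro sum.cong refl)
    fix A assume "A \<in> E"
    then show "lumped_uniform n E A * of_rat (Khat \<Phi> n E A B)
      = (\<Sum>\<pi>\<in>{\<pi> \<in> P. cls \<pi> = A}. (\<Sum>\<tau>\<in>{\<tau> \<in> P. cls \<tau> = B}. q (\<pi> \<circ> inv \<tau>)) / fact n)"
      unfolding lumped_uniform_eq[OF \<open>A \<in> E\<close>] sum_distrib_right
    proof (intro sum.cong refl)
      fix \<pi> assume "\<pi> \<in> {\<pi> \<in> P. cls \<pi> = A}"
      then show "1 / fact n * of_rat (Khat \<Phi> n E A B) = (\<Sum>\<tau>\<in>{\<tau> \<in> P. cls \<tau> = B}. q (\<pi> \<circ> inv \<tau>)) / fact n"
        using Khat_eq[OF _ B, of \<pi>] by simp
    qed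
  qed
  also have "\<dots> = (\<Sum>\<pi>\<in>P. (\<Sum>\<tau>\<in>{\<tau> \<in> P. cls \<tau> = B}. q (\<pi> \<circ> inv \<tau>)) / fact n)"
    by (rule sum_over_classes)
  also have "\<dots> = (\<Sum>\<tau>\<in>{\<tau> \<in> P. cls \<tau> = B}. (\<Sum>\<pi>\<in>P. q (\<pi> \<circ> inv \<tau>)) / fact n)"
    unfolding sum_divide_distrib by (rule sum.swap)
  also have "\<dots> = lumped_uniform n E B"
    unfolding lumped_uniform_eq[OF B] using unif by (intro sum.cong) auto
  finally show "(\<Sum>A\<in>E. lumped_uniform n E A * of_rat (Khat \<Phi> n E A B)) = lumped_uniform n E B" .
qed

text \<open>A minimum principle: a zero of a nonnegative invariant vector spreads to every state
  that leads to it with positive probability. From \<open>w \<circ> z\<close> the walk reaches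
  \<open>z\<close> by the step \<open>w\<close>, so the zero set is closed under left multiplication
  by the descent class.\<close>

lemma invariant_zero:
  assumes v: "\<And>A. A \<in> E \<Longrightarrow> v A \<ge> 0" "\<And>B. B \<in> E \<Longrightarrow> (\<Sum>A\<in>E. v A * of_rat (Khat \<Phi> n E A B)) = v B"
    and zero: "A\<^sub>0 \<in> E" "v A\<^sub>0 = (0 :: real)"
    and S: "S \<subseteq> {1..<n}" "S \<noteq> {}" "S \<noteq> {1..<n}" "\<And>w. Des n w = S \<Longrightarrow> chi n w \<noteq> 0"
    and A: "A \<in> E"
  shows "v A = 0"
proof -
  define Z where "Z = {\<sigma> \<in> P. v (cls \<sigma>) = 0}"
  have "Z = P"
  proof (rule descent_class_generates[OF S(1-3)])
    show "Z \<subseteq> P" by (auto simp: Z_def)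
    show "Z \<noteq> {}" using ex_cls[OF zero(1)] zero(2) by (auto simp: Z_def)
    fix w z assume w: "w permutes {1..n}" "Des n w = S" and z: "z \<in> Z"
    have zp: "z permutes {1..n}" and z0: "v (cls z) = 0" using z by (auto simp: Z_def)
    have wz: "w \<circ> z \<in> P" using permutes_compose[OF zp w(1)] by simp
    have K_nonneg: "of_rat (Khat \<Phi> n E A (cls z)) \<ge> (0::real)" if "A \<in> E" for A
      using ex_cls[OF that] Khat_eq[OF _ cls_in_E] q_nonneg by (metis (no_types, lifting) sum_nonneg)
    have "q w > 0"
      using S(4)[OF w(2)] chi_nonneg[of w] lam_power_pos by (simp add: q_def)
    also have "q w = q ((w \<circ> z) \<circ> inv z)"
      by (simp add: o_assoc[symmetric] permutes_inv_o(1)[OF zp])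
    also have "\<dots> \<le> (\<Sum>\<tau>\<in>{\<tau> \<in> P. cls \<tau> = cls z}. q ((w \<circ> z) \<circ> inv \<tau>))"
      using zp finite_P q_nonneg by (intro member_le_sum) auto
    also have "\<dots> = of_rat (Khat \<Phi> n E (cls (w \<circ> z)) (cls z))"
      using Khat_eq[OF wz cls_in_E] by simp
    finally have "of_rat (Khat \<Phi> n E (cls (w \<circ> z)) (cls z)) > (0::real)" .
    \<comment> \<open>Invariance at \<open>cls z\<close> writes 0 as a sum of nonnegative
      terms.\<close>
    moreover have "\<forall>A\<in>E. v A * of_rat (Khat \<Phi> n E A (cls z)) = 0"
      using v(2)[OF cls_in_E, of z] z0 K_nonneg v(1) finite_E
      by (subst sum_nonneg_eq_0_iff[symmetric]) auto
    ultimately have "v (cls (w \<circ> z)) = 0" using cls_in_E by fastforce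
    then show "w \<circ> z \<in> Z" using wz by (simp add: Z_def)
  qed
  then show ?thesis using ex_cls[OF A] by (auto simp: Z_def)
qed

lemma stationary_unique:
  assumes S: "S \<subseteq> {1..<n}" "S \<noteq> {}" "S \<noteq> {1..<n}" "\<And>w. Des n w = S \<Longrightarrow> chi n w \<noteq> 0"
    and \<mu>: "stationary E (Khat \<Phi> n E) \<mu>"
  shows "\<mu> = lumped_uniform n E"
proof -
  let ?u = "lumped_uniform n E"
  note u = stationary_lumped_uniform[unfolded stationary_def]
  note \<mu>' = \<mu>[unfolded stationary_def]
  \<comment> \<open>The largest multiple of the lumped uniform distribution that can be subtracted
    from \<open>\<mu>\<close> without negative entries; a zero then appears where the minimum is
    attained.\<close>
  define t where "t = Min ((\<lambda>A. \<mu> A / ?u A) ` E)"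
  define v where "v = (\<lambda>A. \<mu> A - t * ?u A)"
  have "E \<noteq> {}" using cls_in_E by blast
  then have "t \<in> (\<lambda>A. \<mu> A / ?u A) ` E"
    unfolding t_def using finite_E by (intro Min_in) auto
  then obtain A\<^sub>0 where A\<^sub>0: "A\<^sub>0 \<in> E" "t = \<mu> A\<^sub>0 / ?u A\<^sub>0" by auto
  have v0: "v A = 0" if "A \<in> E" for A
  proof (rule invariant_zero[OF _ _ A\<^sub>0(1) _ S that])
    fix A assume A: "A \<in> E"
    then have "t \<le> \<mu> A / ?u A" unfolding t_def using finite_E by (intro Min_le) auto
    then show "v A \<ge> 0" using lumped_uniform_pos[OF A] by (simp add: v_def pos_le_divide_eq)
  next
    fix B assume "B \<in> E"
    then show "(\<Sum>A\<in>E. v A * of_rat (Khat \<Phi> n E A B)) = v B"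
      using u \<mu>' by (simp add: v_def left_diff_distrib sum_subtractf mult.assoc sum_distrib_left[symmetric])
  next
    show "v A\<^sub>0 = 0" using lumped_uniform_pos[OF A\<^sub>0(1)] A\<^sub>0(2) by (simp add: v_def)
  qed
  have "0 = (\<Sum>A\<in>E. v A)" using v0 by simp
  also have "\<dots> = 1 - t" using u \<mu>' by (simp add: v_def sum_subtractf sum_distrib_left[symmetric])
  finally have "t = 1" by simp
  then have "\<mu> A = ?u A" if "A \<in> E" for A using v0[OF that] by (simp add: v_def)
  then show ?thesis using u \<mu>' by (intro PiE_ext[of \<mu> E "\<lambda>_. {0..}" ?u]) auto
qed

text \<open>The difficulty is that lumping might identify the distributions carried by different
  pairs. It suffices to separate the class of \<open>id\<close> from those of \<open>s\<close> and
  \<open>rev_perm n \<circ> s\<close> for some \<open>s\<close> whose descent set is neither empty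
  nor full; such an \<open>s\<close> exists because \<open>3 \<le> n\<close>.\<close>

lemma support_trivial_not_unique:
  assumes n: "3 \<le> n"
    and trivial: "\<And>\<sigma>. \<sigma> \<in> P \<Longrightarrow> chi n \<sigma> \<noteq> 0 \<Longrightarrow> Des n \<sigma> = {} \<or> Des n \<sigma> = {1..<n}"
  shows "\<exists>\<mu> \<nu>. stationary E (Khat \<Phi> n E) \<mu> \<and> stationary E (Khat \<Phi> n E) \<nu> \<and> \<mu> \<noteq> \<nu>"
proof -
  let ?w = "rev_perm n"
  define ev where "ev = (\<lambda>\<pi> B. (if cls \<pi> = B then 1 else 0 :: real))"
  define \<nu> where "\<nu> = (\<lambda>\<pi>. \<lambda>B\<in>E. (ev \<pi> B + ev (?w \<circ> \<pi>) B) / 2)"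
  have wP: "?w \<in> P" and idP: "id \<in> P" using rev_perm_permutes by (auto simp: permutes_id)
  have w_comp: "?w \<circ> \<pi> \<in> P" if "\<pi> \<in> P" for \<pi>
    using that permutes_compose[OF _ rev_perm_permutes] by auto
  have "1 \<in> {1..n}" "?w 1 = n" using n by (auto simp: rev_perm_def)
  then have w_id: "?w \<noteq> id" using n by auto
  have supp: "\<sigma> = id \<or> \<sigma> = ?w" if "\<sigma> \<in> P" "chi n \<sigma> \<noteq> 0" for \<sigma>
    using trivial[OF that] that(1) Des_empty_imp_id Des_full_imp_rev by auto
  \<comment> \<open>The weight \<open>chi n (\<pi> \<circ> inv \<tau>)\<close> is supported where
    \<open>\<pi> \<circ> inv \<tau>\<close> is the identity or the reversal, leaving two values of
    \<open>\<tau>\<close>.\<close>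
  have two: "(\<Sum>\<tau>\<in>P. chi n (\<pi> \<circ> inv \<tau>) * f \<tau>) = chi n id * f \<pi> + chi n ?w * f (?w \<circ> \<pi>)"
    if \<pi>: "\<pi> \<in> P" for \<pi> and f :: "(nat \<Rightarrow> nat) \<Rightarrow> rat"
  proof -
    have \<pi>': "\<pi> permutes {1..n}" using \<pi> by simp
    have ne: "\<pi> \<noteq> ?w \<circ> \<pi>"
    proof
      assume "\<pi> = ?w \<circ> \<pi>"
      then have "\<pi> \<circ> inv \<pi> = ?w \<circ> (\<pi> \<circ> inv \<pi>)" by (metis o_assoc)
      then show False using w_id permutes_inv_o(1)[OF \<pi>'] by simp
    qed
    have inv_w: "inv ?w = ?w"
      using rev_perm_comp(1) by (metis inv_unique_comp)
    have inv_wp: "\<pi> \<circ> inv (?w \<circ> \<pi>) = ?w"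
    proof -
      have "inv (?w \<circ> \<pi>) = inv \<pi> \<circ> ?w"
        using permutes_bij[OF \<pi>'] permutes_bij[OF rev_perm_permutes[of n]] inv_w by (simp add: o_inv_distrib)
      then show ?thesis using permutes_inv_o(1)[OF \<pi>'] by (simp add: o_assoc)
    qed
    have "(\<Sum>\<tau>\<in>P. chi n (\<pi> \<circ> inv \<tau>) * f \<tau>) = (\<Sum>\<tau>\<in>{\<pi>, ?w \<circ> \<pi>}. chi n (\<pi> \<circ> inv \<tau>) * f \<tau>)"
    proof (rule sum.mono_neutral_right[OF finite_P])
      show "{\<pi>, ?w \<circ> \<pi>} \<subseteq> P" using \<pi> w_comp by auto
      show "\<forall>\<tau>\<in>P - {\<pi>, ?w \<circ> \<pi>}. chi n (\<pi> \<circ> inv \<tau>) * f \<tau> = 0"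
      proof (rule ballI, rule ccontr)
        fix \<tau> assume \<tau>: "\<tau> \<in> P - {\<pi>, ?w \<circ> \<pi>}" and nz: "chi n (\<pi> \<circ> inv \<tau>) * f \<tau> \<noteq> 0"
        have \<tau>': "\<tau> permutes {1..n}" using \<tau> by simp
        have "\<pi> \<circ> inv \<tau> \<in> P" using \<pi>' \<tau>' by (simp add: permutes_compose permutes_inv)
        then have "\<pi> \<circ> inv \<tau> = id \<or> \<pi> \<circ> inv \<tau> = ?w" using supp nz by auto
        moreover have "(\<pi> \<circ> inv \<tau>) \<circ> \<tau> = \<pi>" by (simp add: o_assoc[symmetric] permutes_inv_o(2)[OF \<tau>'])
        ultimately have "\<tau> = \<pi> \<or> ?w \<circ> \<tau> = \<pi>" by auto
        then show False using \<tau> rev_perm_comp(2)[of n \<tau>] by auto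
      qed
    qed
    also have "\<dots> = chi n id * f \<pi> + chi n ?w * f (?w \<circ> \<pi>)"
      using ne permutes_inv_o(1)[OF \<pi>'] inv_wp by simp
    finally show ?thesis .
  qed
  have sum_ab: "chi n id + chi n ?w = lam \<Phi> ^ n"
  proof -
    have "chi n id + chi n ?w = (\<Sum>\<tau>\<in>P. chi n (inv \<tau>))"
      using two[OF idP, of "\<lambda>_. 1"] by simp
    also have "\<dots> = (\<Sum>\<sigma>\<in>P. chi n \<sigma>)"
      by (rule sum.reindex_bij_witness[of _ inv inv]) (auto simp: permutes_inv permutes_inv_inv)
    finally show ?thesis by (simp only: sum_chi)
  qed
  have q1: "q id + q ?w = 1"
    unfolding q_def of_rat_add[symmetric] add_divide_distrib[symmetric] sum_ab lam_power_divide_self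
    by simp
  have K: "of_rat (Khat \<Phi> n E (cls \<pi>) B) = q id * ev \<pi> B + q ?w * ev (?w \<circ> \<pi>) B"
    if \<pi>: "\<pi> \<in> P" and B: "B \<in> E" for \<pi> B
  proof -
    let ?f = "\<lambda>\<tau>. if cls \<tau> = B then 1 else 0 :: rat"
    have "of_rat (Khat \<Phi> n E (cls \<pi>) B) = (\<Sum>\<tau>\<in>P. if cls \<tau> = B then q (\<pi> \<circ> inv \<tau>) else 0)"
      unfolding Khat_eq[OF \<pi> B] by (rule sum.inter_filter[OF finite_P])
    also have "\<dots> = of_rat ((\<Sum>\<tau>\<in>P. chi n (\<pi> \<circ> inv \<tau>) * ?f \<tau>) / lam \<Phi> ^ n)"
      unfolding sum_divide_distrib of_rat_sum q_def by (intro sum.cong) auto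
    also have "\<dots> = q id * ev \<pi> B + q ?w * ev (?w \<circ> \<pi>) B"
      unfolding two[OF \<pi>] by (auto simp: q_def ev_def of_rat_add add_divide_distrib)
    finally show ?thesis .
  qed
  have sum_ev: "(\<Sum>A\<in>E. ev \<pi> A * g A) = g (cls \<pi>)" for \<pi> and g :: "nat list set \<Rightarrow> real"
  proof -
    have "(\<Sum>A\<in>E. ev \<pi> A * g A) = (\<Sum>A\<in>E. if cls \<pi> = A then g A else 0)"
      by (intro sum.cong) (auto simp: ev_def)
    then show ?thesis using finite_E cls_in_E by simp
  qed
  have st: "stationary E (Khat \<Phi> n E) (\<nu> \<pi>)" if \<pi>: "\<pi> \<in> P" for \<pi>
    unfolding stationary_def
  proof (intro conjI ballI)
    show "\<nu> \<pi> \<in> E \<rightarrow>\<^sub>E {0..}" by (auto simp: \<nu>_def ev_def)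
    have lin: "(\<Sum>A\<in>E. \<nu> \<pi> A * g A) = (g (cls \<pi>) + g (cls (?w \<circ> \<pi>))) / 2" for g
    proof -
      have "(\<Sum>A\<in>E. \<nu> \<pi> A * g A) = (\<Sum>A\<in>E. (ev \<pi> A * g A + ev (?w \<circ> \<pi>) A * g A) / 2)"
        by (intro sum.cong) (auto simp: \<nu>_def algebra_simps)
      then show ?thesis by (simp add: sum_divide_distrib[symmetric] sum.distrib sum_ev)
    qed
    show "(\<Sum>A\<in>E. \<nu> \<pi> A) = 1" using lin[of "\<lambda>_. 1"] by simp
    fix B assume B: "B \<in> E"
    have "(\<Sum>A\<in>E. \<nu> \<pi> A * of_rat (Khat \<Phi> n E A B)) = (q id + q ?w) * (ev \<pi> B + ev (?w \<circ> \<pi>) B) / 2"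
      unfolding lin K[OF \<pi> B] K[OF w_comp[OF \<pi>] B] by (simp add: algebra_simps)
    then show "(\<Sum>A\<in>E. \<nu> \<pi> A * of_rat (Khat \<Phi> n E A B)) = \<nu> \<pi> B"
      using B by (simp add: q1 \<nu>_def)
  qed
  \<comment> \<open>Equal classes would give equal images under \<open>\<Phi>\<close>. Comparing
    values at the empty set kills \<open>chi n id\<close>, and then comparing at the complement of
    \<open>Des n \<pi>\<close> kills \<open>chi n (rev_perm n)\<close>, although their sum is
    positive.\<close>
  have no_eq: "cls id \<noteq> cls \<pi>" if \<pi>: "\<pi> \<in> P" and X: "Des n \<pi> \<noteq> {}" "Des n \<pi> \<noteq> {1..<n}" for \<pi>
  proof
    assume "cls id = cls \<pi>"
    then have eq: "\<Phi> (F n (Des n id)) = \<Phi> (F n (Des n \<pi>))" by (metis class_val_cls)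
    have val: "\<Phi> (F n (Des n \<rho>)) (packed_mono n T)
        = chi n id * (if Des n \<rho> \<subseteq> T then 1 else 0) + chi n ?w * (if {1..<n} - Des n \<rho> \<subseteq> T then 1 else 0)"
      if \<rho>: "\<rho> \<in> P" and T: "T \<subseteq> {1..<n}" for \<rho> T
    proof -
      have "\<Phi> (F n (Des n \<rho>)) (packed_mono n T) = (\<Sum>\<tau>\<in>P. chi n (\<rho> \<circ> inv \<tau>) * F n (Des n \<tau>) (packed_mono n T))"
        using Phi_F_expansion[of \<rho> n] \<rho> by (simp add: sum_fun_apply fscale_apply)
      also have "\<dots> = chi n id * F n (Des n \<rho>) (packed_mono n T) + chi n ?w * F n (Des n (?w \<circ> \<rho>)) (packed_mono n T)"
        by (rule two[OF \<rho>])
      finally show ?thesis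
        using F_packed_mono[OF T] \<rho> Des_subset[of n \<rho>] by (simp add: Des_rev_perm_comp Int_absorb2 Int_absorb1 Diff_Int_distrib2)
    qed
    have Did: "Des n id = {}" by (auto simp: Des_def)
    have X': "{1..<n} - Des n \<pi> \<noteq> {}" "Des n \<pi> \<subseteq> {1..<n}" using X Des_subset by blast+
    have ne: "\<not> {1..<n} \<subseteq> {}" using n by auto
    have a: "chi n id = 0"
      using val[OF idP, of "{}"] val[OF \<pi>, of "{}"] eq X X' ne by (simp add: Did)
    have c: "\<not> {1..<n} \<subseteq> {1..<n} - Des n \<pi>" using X X' by blast
    have b: "chi n ?w = 0"
      using val[OF idP, of "{1..<n} - Des n \<pi>"] val[OF \<pi>, of "{1..<n} - Des n \<pi>"] eq a c
      by (simp add: Did)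
    show False using a b sum_ab lam_power_pos by simp
  qed
  obtain s where s: "s \<in> P" "Des n s = {1}"
    using ex_permutes_Des[of "{1}" n] n by auto
  have "{1::nat} \<noteq> {1..<n}" "{1..<n} - {1} \<noteq> {1..<n}" "{1..<n} - {1} \<noteq> {}"
  proof -
    have "2 \<in> {1..<n} - {1}" "1 \<in> {1..<n}" using n by auto
    then show "{1::nat} \<noteq> {1..<n}" "{1..<n} - {1} \<noteq> {1..<n}" "{1..<n} - {1} \<noteq> {}" by blast+
  qed
  then have "cls id \<noteq> cls s" "cls id \<noteq> cls (?w \<circ> s)"
    using no_eq[OF s(1)] no_eq[OF w_comp[OF s(1)]] s Des_rev_perm_comp[of s n] by auto
  \<comment> \<open>\<open>\<nu> id\<close> has mass at least 1/2 at \<open>cls id\<close>, while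
    \<open>\<nu> s\<close> has none there.\<close>
  then have "\<nu> id (cls id) \<noteq> \<nu> s (cls id)"
    using cls_in_E[of id] by (simp add: \<nu>_def ev_def)
  then have "\<nu> id \<noteq> \<nu> s" by auto
  then show ?thesis using st[OF idP] st[OF s(1)] by blast
qed

lemma nontrivial_support_iff:
  "(\<exists>\<alpha>\<in>Comp n - {one_row n, one_col n}. cmat \<Phi> \<alpha> (one_row n) \<noteq> 0) \<longleftrightarrow>
   (\<exists>\<sigma>\<in>P. chi n \<sigma> \<noteq> 0 \<and> Des n \<sigma> \<noteq> {} \<and> Des n \<sigma> \<noteq> {1..<n})"
proof
  assume "\<exists>\<alpha>\<in>Comp n - {one_row n, one_col n}. cmat \<Phi> \<alpha> (one_row n) \<noteq> 0"
  then obtain \<alpha> where \<alpha>: "\<alpha> \<in> Comp n" "\<alpha> \<noteq> one_row n" "\<alpha> \<noteq> one_col n" "cmat \<Phi> \<alpha> (one_row n) \<noteq> 0"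
    by auto
  then obtain \<sigma> where \<sigma>: "\<sigma> \<in> P" "Dcomp n \<sigma> = \<alpha>" using ex_Dcomp by blast
  then have "Des n \<sigma> \<noteq> {}" "Des n \<sigma> \<noteq> {1..<n}"
    using \<alpha> Dcomp_eq_iff[OF one_row_Comp, of n \<sigma>] Dcomp_eq_iff[OF one_col_Comp, of n \<sigma>]
    by (auto simp: part_sums_one_col)
  then show "\<exists>\<sigma>\<in>P. chi n \<sigma> \<noteq> 0 \<and> Des n \<sigma> \<noteq> {} \<and> Des n \<sigma> \<noteq> {1..<n}"
    using \<sigma> \<alpha> cmat_one_row[of n \<sigma>] by auto
next
  assume "\<exists>\<sigma>\<in>P. chi n \<sigma> \<noteq> 0 \<and> Des n \<sigma> \<noteq> {} \<and> Des n \<sigma> \<noteq> {1..<n}"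
  then obtain \<sigma> where \<sigma>: "\<sigma> \<in> P" "chi n \<sigma> \<noteq> 0" "Des n \<sigma> \<noteq> {}" "Des n \<sigma> \<noteq> {1..<n}" by blast
  have "Dcomp n \<sigma> \<in> Comp n - {one_row n, one_col n}"
    using \<sigma> Dcomp_in_Comp Dcomp_eq_iff[OF one_row_Comp, of n \<sigma>] Dcomp_eq_iff[OF one_col_Comp, of n \<sigma>]
    by (auto simp: part_sums_one_col)
  then show "\<exists>\<alpha>\<in>Comp n - {one_row n, one_col n}. cmat \<Phi> \<alpha> (one_row n) \<noteq> 0"
    using \<sigma> cmat_one_row by metis
qed

end

theorem theorem3p13:
  fixes \<Phi> :: "pser \<Rightarrow> pser" and n :: nat and r :: "(nat list \<times> nat list) set"
    and E :: "nat list set set"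
  assumes "\<Phi> \<in> hopf_End"
    and "partitioning \<Phi> n r"
    and "E = Comp n // r"
    and "\<And>\<alpha>. \<alpha> \<in> Comp n \<Longrightarrow> cmat \<Phi> \<alpha> (one_row n) \<ge> 0"
    and "\<exists>\<alpha>\<in>Comp n. cmat \<Phi> \<alpha> (one_row n) \<noteq> 0"
  shows "(3 \<le> n \<longrightarrow>
            ((\<exists>!\<mu>. stationary E (Khat \<Phi> n E) \<mu>) \<longleftrightarrow>
             (\<exists>\<alpha>\<in>Comp n - {one_row n, one_col n}. cmat \<Phi> \<alpha> (one_row n) \<noteq> 0)))
       \<and> ((\<exists>!\<mu>. stationary E (Khat \<Phi> n E) \<mu>) \<longrightarrow>
            (\<forall>\<mu>. stationary E (Khat \<Phi> n E) \<mu> \<longleftrightarrow> \<mu> = lumped_uniform n E))"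
proof -
  interpret partitioned_endomorphism \<Phi> n r E
    by unfold_locales (use assms in blast)+
  show ?thesis
    unfolding nontrivial_support_iff
  proof (intro conjI impI iffI)
    assume n: "3 \<le> n" and "\<exists>!\<mu>. stationary E (Khat \<Phi> n E) \<mu>"
    then show "\<exists>\<sigma>\<in>P. chi n \<sigma> \<noteq> 0 \<and> Des n \<sigma> \<noteq> {} \<and> Des n \<sigma> \<noteq> {1..<n}"
      using support_trivial_not_unique[OF n] by metis
  next
    assume "\<exists>\<sigma>\<in>P. chi n \<sigma> \<noteq> 0 \<and> Des n \<sigma> \<noteq> {} \<and> Des n \<sigma> \<noteq> {1..<n}"
    then obtain \<sigma> where "chi n \<sigma> \<noteq> 0" "Des n \<sigma> \<noteq> {}" "Des n \<sigma> \<noteq> {1..<n}" by blast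
    then have "\<mu> = lumped_uniform n E" if "stationary E (Khat \<Phi> n E) \<mu>" for \<mu>
      using stationary_unique[OF Des_subset, of \<sigma> \<mu>] chi_cong that by metis
    then show "\<exists>!\<mu>. stationary E (Khat \<Phi> n E) \<mu>"
      using stationary_lumped_uniform by blast
  next
    assume "\<exists>!\<mu>. stationary E (Khat \<Phi> n E) \<mu>"
    then show "\<forall>\<mu>. stationary E (Khat \<Phi> n E) \<mu> \<longleftrightarrow> \<mu> = lumped_uniform n E"
      using stationary_lumped_uniform by blast
  qed
qed

end
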